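(* Let $A$ be a commutative ring. The following statements are equivalent. (i) $A$ is a reduced mp-ring. (ii) If $fg=0$ for some $f,g\in A$, then $\operatorname{Ann}(f)+\operatorname{Ann}(g)=A$. (iii) $\operatorname{Ann}(f)+\operatorname{Ann}(g)=\operatorname{Ann}(fg)$ for all $f,g\in A$. (iv) $\operatorname{Ann}(f)$ is a pure ideal for all $f\in A$. (v) Every principal ideal of $A$ is a flat $A$-module. (vi) If $\mathfrak{p}$ is a prime ideal of $A$, then $A_{\mathfrak{p}}$ is an integral domain. (vii) If $\mathfrak{m}$ is a maximal ideal of $A$, then $A_{\mathfrak{m}}$ is an integral domain. (viii) Every minimal prime ideal of $A$ is a pure ideal.
   Context: All rings are commutative (with unit). A ring $A$ is a mp-ring if each prime ideal of $A$ contains a unique minimal prime ideal of $A$. An ideal $I$ of $A$ is pure if the canonical ring map $A\to A/I$ is flat. *)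

theory Defs
  imports "HOL-Algebra.Algebra"
begin

subsection \<open>Ideals and prime ideals\<close>

definition annihilator :: "('a, 'm) ring_scheme \<Rightarrow> 'a \<Rightarrow> 'a set" where
  "annihilator R f = {a \<in> carrier R. a \<otimes>\<^bsub>R\<^esub> f = \<zero>\<^bsub>R\<^esub>}"

definition reduced_ring :: "('a, 'm) ring_scheme \<Rightarrow> bool" where
  "reduced_ring R \<longleftrightarrow>
     (\<forall>a \<in> carrier R. \<forall>n::nat. a [^]\<^bsub>R\<^esub> n = \<zero>\<^bsub>R\<^esub> \<longrightarrow> a = \<zero>\<^bsub>R\<^esub>)"

definition minimal_primeideal :: "'a set \<Rightarrow> ('a, 'm) ring_scheme \<Rightarrow> bool" where
  "minimal_primeideal P R \<longleftrightarrow>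
     primeideal P R \<and> (\<forall>Q. primeideal Q R \<and> Q \<subseteq> P \<longrightarrow> Q = P)"

definition mp_ring :: "('a, 'm) ring_scheme \<Rightarrow> bool" where
  "mp_ring R \<longleftrightarrow>
     cring R \<and> (\<forall>Q. primeideal Q R \<longrightarrow> (\<exists>!P. minimal_primeideal P R \<and> P \<subseteq> Q))"


subsection \<open>Localization\<close>

definition fraction_rel ::
  "('a, 'm) ring_scheme \<Rightarrow> 'a set \<Rightarrow> (('a \<times> 'a) \<times> ('a \<times> 'a)) set" where
  "fraction_rel R S =
     {((a, s), (b, t)) | a s b t. a \<in> carrier R \<and> s \<in> S \<and> b \<in> carrier R \<and> t \<in> S \<and>
        (\<exists>u \<in> S. u \<otimes>\<^bsub>R\<^esub> ((a \<otimes>\<^bsub>R\<^esub> t) \<ominus>\<^bsub>R\<^esub> (b \<otimes>\<^bsub>R\<^esub> s)) = \<zero>\<^bsub>R\<^esub>)}"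

definition fraction :: "('a, 'm) ring_scheme \<Rightarrow> 'a set \<Rightarrow> 'a \<Rightarrow> 'a \<Rightarrow> ('a \<times> 'a) set" where
  "fraction R S a s = fraction_rel R S `` {(a, s)}"

text \<open>Meaningful for \<open>S\<close> multiplicatively closed with \<open>\<one> \<in> S\<close>; the unions below are then
  taken over families with a single distinct member.\<close>

definition localization :: "('a, 'm) ring_scheme \<Rightarrow> 'a set \<Rightarrow> ('a \<times> 'a) set ring" where
  "localization R S =
     \<lparr>carrier = (carrier R \<times> S) // fraction_rel R S,
      monoid.mult = (\<lambda>C D. \<Union>(a, s) \<in> C. \<Union>(b, t) \<in> D. fraction R S (a \<otimes>\<^bsub>R\<^esub> b) (s \<otimes>\<^bsub>R\<^esub> t)),
      monoid.one = fraction R S \<one>\<^bsub>R\<^esub> \<one>\<^bsub>R\<^esub>,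
      ring.zero = fraction R S \<zero>\<^bsub>R\<^esub> \<one>\<^bsub>R\<^esub>,
      ring.add = (\<lambda>C D. \<Union>(a, s) \<in> C. \<Union>(b, t) \<in> D.
               fraction R S ((a \<otimes>\<^bsub>R\<^esub> t) \<oplus>\<^bsub>R\<^esub> (b \<otimes>\<^bsub>R\<^esub> s)) (s \<otimes>\<^bsub>R\<^esub> t))\<rparr>"

definition localization_at :: "('a, 'm) ring_scheme \<Rightarrow> 'a set \<Rightarrow> ('a \<times> 'a) set ring" where
  "localization_at R P = localization R (carrier R - P)"


subsection \<open>Tensor products and flatness\<close>

definition module_hom ::
  "('a, 'm) ring_scheme \<Rightarrow> ('a, 'b, 'x) module_scheme \<Rightarrow> ('a, 'c, 'y) module_scheme
     \<Rightarrow> ('b \<Rightarrow> 'c) set" where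
  "module_hom R M N =
     {f \<in> carrier M \<rightarrow> carrier N.
        (\<forall>x \<in> carrier M. \<forall>y \<in> carrier M. f (x \<oplus>\<^bsub>M\<^esub> y) = f x \<oplus>\<^bsub>N\<^esub> f y) \<and>
        (\<forall>a \<in> carrier R. \<forall>x \<in> carrier M. f (a \<odot>\<^bsub>M\<^esub> x) = a \<odot>\<^bsub>N\<^esub> f x)}"

definition tensor_relators ::
  "('a, 'm) ring_scheme \<Rightarrow> ('a, 'b, 'x) module_scheme \<Rightarrow> ('a, 'c, 'y) module_scheme
     \<Rightarrow> (('b \<times> 'c) \<Rightarrow>\<^sub>0 int) set" where
  "tensor_relators R M N =
     {frag_of (x \<oplus>\<^bsub>M\<^esub> x', y) - (frag_of (x, y) + frag_of (x', y)) | x x' y.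
        x \<in> carrier M \<and> x' \<in> carrier M \<and> y \<in> carrier N} \<union>
     {frag_of (x, y \<oplus>\<^bsub>N\<^esub> y') - (frag_of (x, y) + frag_of (x, y')) | x y y'.
        x \<in> carrier M \<and> y \<in> carrier N \<and> y' \<in> carrier N} \<union>
     {frag_of (a \<odot>\<^bsub>M\<^esub> x, y) - frag_of (x, a \<odot>\<^bsub>N\<^esub> y) | a x y.
        a \<in> carrier R \<and> x \<in> carrier M \<and> y \<in> carrier N}"

definition tensor_subgroup ::
  "('a, 'm) ring_scheme \<Rightarrow> ('a, 'b, 'x) module_scheme \<Rightarrow> ('a, 'c, 'y) module_scheme
     \<Rightarrow> (('b \<times> 'c) \<Rightarrow>\<^sub>0 int) set" where
  "tensor_subgroup R M N =
     generate (free_Abelian_group (carrier M \<times> carrier N)) (tensor_relators R M N)"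

text \<open>The underlying abelian group of the tensor product over \<open>R\<close>, written multiplicatively;
  its \<open>R\<close>-module structure is not needed for flatness, which only concerns injectivity.\<close>

definition tensor_product ::
  "('a, 'm) ring_scheme \<Rightarrow> ('a, 'b, 'x) module_scheme \<Rightarrow> ('a, 'c, 'y) module_scheme
     \<Rightarrow> (('b \<times> 'c) \<Rightarrow>\<^sub>0 int) set monoid" where
  "tensor_product R M N =
     free_Abelian_group (carrier M \<times> carrier N) Mod tensor_subgroup R M N"

text \<open>The map \<open>f \<otimes> id\<close> from \<open>N \<otimes> M\<close> to \<open>N' \<otimes> M\<close>. Elements are cosets of formal sums; the union
  is over a family with a single distinct member when \<open>f\<close> is \<open>R\<close>-linear.\<close>

definition tensor_map ::
  "('a, 'm) ring_scheme \<Rightarrow> ('a, 'd, 'z) module_scheme \<Rightarrow> ('a, 'b, 'x) module_scheme \<Rightarrow> ('c \<Rightarrow> 'd)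
     \<Rightarrow> (('c \<times> 'b) \<Rightarrow>\<^sub>0 int) set \<Rightarrow> (('d \<times> 'b) \<Rightarrow>\<^sub>0 int) set" where
  "tensor_map R N' M f C =
     (\<Union>c \<in> C. tensor_subgroup R N' M
        #>\<^bsub>free_Abelian_group (carrier N' \<times> carrier M)\<^esub>
        frag_extend (\<lambda>(x, y). frag_of (f x, y)) c)"

text \<open>\<open>M\<close> is flat if \<open>- \<otimes> M\<close> preserves injectivity of all \<open>R\<close>-linear maps \<open>N \<rightarrow> N'\<close>. HOL cannot
  quantify over types inside a formula, so the type \<open>'u\<close> in which the test modules \<open>N\<close>, \<open>N'\<close> live
  is a parameter, playing the role of a universe. It has to be at least as large as \<open>R\<close> for the
  notion to be the usual one (all ideals of \<open>R\<close> are then available as test modules).\<close>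

definition flat_module ::
  "'u itself \<Rightarrow> ('a, 'm) ring_scheme \<Rightarrow> ('a, 'b, 'x) module_scheme \<Rightarrow> bool" where
  "flat_module U R M \<longleftrightarrow>
     module R M \<and>
     (\<forall>(N :: ('a, 'u) module) (N' :: ('a, 'u) module) f.
        module R N \<and> module R N' \<and> f \<in> module_hom R N N' \<and> inj_on f (carrier N) \<longrightarrow>
        inj_on (tensor_map R N' M f) (carrier (tensor_product R N M)))"

definition ideal_module :: "('a, 'm) ring_scheme \<Rightarrow> 'a set \<Rightarrow> ('a, 'a) module" where
  "ideal_module R I =
     \<lparr>carrier = I, monoid.mult = monoid.mult R, monoid.one = monoid.one R, ring.zero = ring.zero R,
      ring.add = ring.add R, smult = monoid.mult R\<rparr>"

definition restrict_scalars :: "('b, 'm) ring_scheme \<Rightarrow> ('a \<Rightarrow> 'b) \<Rightarrow> ('a, 'b) module" where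
  "restrict_scalars S h =
     \<lparr>carrier = carrier S, monoid.mult = monoid.mult S, monoid.one = monoid.one S,
      ring.zero = ring.zero S,
      ring.add = ring.add S, smult = (\<lambda>a x. h a \<otimes>\<^bsub>S\<^esub> x)\<rparr>"

definition flat_ring_hom ::
  "'u itself \<Rightarrow> ('a, 'm) ring_scheme \<Rightarrow> ('b, 'n) ring_scheme \<Rightarrow> ('a \<Rightarrow> 'b) \<Rightarrow> bool" where
  "flat_ring_hom U R S h \<longleftrightarrow> h \<in> ring_hom R S \<and> flat_module U R (restrict_scalars S h)"

definition pure_ideal :: "'u itself \<Rightarrow> 'a set \<Rightarrow> ('a, 'm) ring_scheme \<Rightarrow> bool" where
  "pure_ideal U I R \<longleftrightarrow> ideal I R \<and> flat_ring_hom U R (R Quot I) (\<lambda>a. I +>\<^bsub>R\<^esub> a)"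


definition all_equivalent :: "bool list \<Rightarrow> bool" where
  "all_equivalent Ps \<longleftrightarrow> (\<forall>P \<in> set Ps. \<forall>Q \<in> set Ps. P \<longleftrightarrow> Q)"

end

theory Submission
  imports Defs
begin

text \<open>
  All conditions are compared with the comaximality condition: \<open>f g = 0\<close> implies
  \<open>Ann f + Ann g = A\<close>. Say that an ideal \<open>I\<close> has local units if each \<open>x \<in> I\<close> satisfies \<open>g x = x\<close> for
  some \<open>g \<in> I\<close>. This is the same as \<open>Ann x + I = A\<close> for all \<open>x \<in> I\<close>, so the comaximality condition says
  that all annihilators \<open>Ann f\<close> have local units. It also yields \<open>Ann f + Ann g = Ann (f g)\<close>, by applying
  it to \<open>a f\<close> and \<open>g\<close> whenever \<open>a f g = 0\<close>, and it makes the ring reduced, since local units lower the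
  exponent in \<open>a^n = 0\<close>. Three ideas give the other conditions.

  Flatness. A cyclic module \<open>A e\<close> is flat if and only if the annihilator of \<open>e\<close> has local units
  (\<open>flat_iff_has_local_units\<close>). For \<open>A / I\<close> this identifies the pure ideals with the ideals that have
  local units; for a principal ideal \<open>A f\<close> the annihilator of the generator is \<open>Ann f\<close>. So purity of the
  annihilators and flatness of the principal ideals are both the comaximality condition.

  Localization. The kernel \<open>K\<close> of \<open>A \<rightarrow> A\<^sub>Q\<close> at a prime \<open>Q\<close> lies in every prime inside \<open>Q\<close>, and \<open>A\<^sub>Q\<close>
  is a domain exactly if \<open>K\<close> is prime. Local units in all annihilators make \<open>K\<close> prime for every \<open>Q\<close>.
  Then \<open>K\<close> is the least prime inside \<open>Q\<close>, which gives a unique minimal prime there. Conversely, if \<open>K\<close> is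
  prime at each maximal ideal \<open>M\<close> and \<open>f g = 0\<close>, then \<open>f\<close> or \<open>g\<close> dies in \<open>A\<^sub>M\<close>, so \<open>M\<close> cannot contain
  both annihilators.

  Minimal primes. In a reduced mp-ring each minimal prime \<open>P\<close> has local units: otherwise some maximal
  ideal contains \<open>P\<close> and \<open>Ann x\<close> for an \<open>x \<in> P\<close>, and a prime avoiding the products \<open>s x^n\<close> produces a
  second minimal prime below that maximal ideal. Conversely, if every minimal prime has local units and
  \<open>f g = 0\<close>, then a maximal ideal containing \<open>Ann f\<close> and \<open>Ann g\<close> contains a minimal prime, which contains
  \<open>f\<close> or \<open>g\<close> and is comaximal with its annihilator, a contradiction.
\<close>

section \<open>Local units and annihilators\<close>

text \<open>For an ideal this turns out to be purity, stated on elements; over a cyclic module it is what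
  flatness asks of the annihilator of a generator.\<close>

definition has_local_units :: "('a, 'm) ring_scheme \<Rightarrow> 'a set \<Rightarrow> bool" where
  "has_local_units R I \<longleftrightarrow> (\<forall>x \<in> I. \<exists>g \<in> I. g \<otimes>\<^bsub>R\<^esub> x = x)"

context cring
begin

lemma annihilator_ideal:
  assumes "f \<in> carrier R"
  shows "ideal (annihilator R f) R"
proof (rule idealI[OF ring_axioms], rule add.subgroupI)
  show "annihilator R f \<subseteq> carrier R"
    unfolding annihilator_def by blast
  have "\<zero> \<in> annihilator R f"
    using assms by (simp add: annihilator_def)
  then show "annihilator R f \<noteq> {}"
    by blast
  fix a assume a: "a \<in> annihilator R f"
  show "x \<otimes> a \<in> annihilator R f" if "x \<in> carrier R" for x
    using a that assms by (simp add: annihilator_def m_assoc)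
  moreover have "a \<otimes> x = x \<otimes> a" if "x \<in> carrier R" for x
    using a that by (simp add: annihilator_def m_comm)
  ultimately show "a \<otimes> x \<in> annihilator R f" if "x \<in> carrier R" for x
    using that by metis
  show "\<ominus> a \<in> annihilator R f"
    using a assms by (simp add: annihilator_def l_minus)
  show "a \<oplus> b \<in> annihilator R f" if "b \<in> annihilator R f" for b
    using a that assms by (simp add: annihilator_def l_distr)
qed

lemma add_ideals_superset:
  assumes "ideal I R" "ideal J R"
  shows "I \<subseteq> I <+> J" "J \<subseteq> I <+> J"
proof -
  interpret I: ideal I R by (rule assms)
  interpret J: ideal J R by (rule assms)
  show "I \<subseteq> I <+> J"
  proof
    fix x assume "x \<in> I"
    then have "x = x \<oplus> \<zero>"
      using I.Icarr by simp
    then show "x \<in> I <+> J"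
      unfolding set_add_def' using \<open>x \<in> I\<close> J.zero_closed by blast
  qed
  show "J \<subseteq> I <+> J"
  proof
    fix x assume "x \<in> J"
    then have "x = \<zero> \<oplus> x"
      using J.Icarr by simp
    then show "x \<in> I <+> J"
      unfolding set_add_def' using \<open>x \<in> J\<close> I.zero_closed by blast
  qed
qed

text \<open>If \<open>\<one> = a + g\<close> with \<open>a x = 0\<close>, then \<open>x = g x\<close>; conversely \<open>g x = x\<close> makes \<open>\<one> - g\<close> kill
  \<open>x\<close>. This is the bridge between the comaximality conditions and local units.\<close>

lemma comaximal_annihilator_iff:
  assumes x: "x \<in> carrier R" and I: "ideal I R"
  shows "annihilator R x <+> I = carrier R \<longleftrightarrow> (\<exists>g \<in> I. g \<otimes> x = x)"
proof
  interpret I: ideal I R by (rule I)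
  show "\<exists>g \<in> I. g \<otimes> x = x" if "annihilator R x <+> I = carrier R"
  proof -
    have "\<one> \<in> annihilator R x <+> I"
      using that by simp
    then obtain a g where a: "a \<in> annihilator R x" and g: "g \<in> I" and one: "\<one> = a \<oplus> g"
      by (auto simp: set_add_def')
    have "x = (a \<oplus> g) \<otimes> x"
      using x by (simp flip: one)
    also have "\<dots> = g \<otimes> x"
      using x a I.Icarr[OF g] by (simp add: l_distr annihilator_def)
    finally show ?thesis
      using g by (intro bexI[of _ g]) simp_all
  qed
  show "annihilator R x <+> I = carrier R" if "\<exists>g \<in> I. g \<otimes> x = x"
  proof -
    obtain g where g: "g \<in> I" "g \<otimes> x = x"
      using \<open>\<exists>g \<in> I. g \<otimes> x = x\<close> by blast
    have gR: "g \<in> carrier R"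
      by (rule I.Icarr[OF g(1)])
    have "\<one> \<ominus> g \<in> annihilator R x"
      using x g gR by (simp add: annihilator_def a_minus_def l_distr l_minus r_neg)
    moreover have "\<one> = (\<one> \<ominus> g) \<oplus> g"
      using gR by (simp add: a_minus_def a_assoc l_neg)
    ultimately have "\<one> \<in> annihilator R x <+> I"
      using g unfolding set_add_def' by blast
    then show ?thesis
      by (rule ideal.one_imp_carrier[OF add_ideals[OF annihilator_ideal[OF x] I]])
  qed
qed

lemma has_local_units_iff_comaximal:
  assumes "ideal I R"
  shows "has_local_units R I \<longleftrightarrow> (\<forall>x \<in> I. annihilator R x <+> I = carrier R)"
proof -
  interpret ideal I R by (rule assms)
  have "(\<exists>g \<in> I. g \<otimes> x = x) \<longleftrightarrow> annihilator R x <+> I = carrier R" if "x \<in> I" for x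
    by (rule comaximal_annihilator_iff[OF Icarr[OF that] assms, symmetric])
  then show ?thesis
    by (simp add: has_local_units_def)
qed

lemma annihilators_have_local_units_iff:
  "(\<forall>f \<in> carrier R. has_local_units R (annihilator R f)) \<longleftrightarrow>
    (\<forall>f \<in> carrier R. \<forall>g \<in> carrier R. f \<otimes> g = \<zero> \<longrightarrow> annihilator R f <+> annihilator R g = carrier R)"
proof -
  have "has_local_units R (annihilator R g) \<longleftrightarrow>
      (\<forall>f \<in> carrier R. f \<otimes> g = \<zero> \<longrightarrow> annihilator R f <+> annihilator R g = carrier R)"
    if "g \<in> carrier R" for g
    using has_local_units_iff_comaximal[OF annihilator_ideal[OF that]] by (auto simp: annihilator_def)
  then show ?thesis
    by blast
qed

text \<open>The inclusion of the sum in \<open>Ann (f g)\<close> always holds. For the other one, \<open>a f g = 0\<close> makes \<open>a f\<close>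
  and \<open>g\<close> a pair with product zero; a unit \<open>v \<in> Ann g\<close> for \<open>a f\<close> then splits
  \<open>a = (a - a v) + a v\<close>.\<close>

lemma comaximal_annihilators_iff_sum_formula:
  "(\<forall>f \<in> carrier R. \<forall>g \<in> carrier R. f \<otimes> g = \<zero> \<longrightarrow> annihilator R f <+> annihilator R g = carrier R) \<longleftrightarrow>
    (\<forall>f \<in> carrier R. \<forall>g \<in> carrier R. annihilator R f <+> annihilator R g = annihilator R (f \<otimes> g))"
  (is "?zd \<longleftrightarrow> ?sum")
proof
  have "annihilator R \<zero> = carrier R"
    by (auto simp: annihilator_def)
  then show ?zd if ?sum
    using that by metis
  show ?sum if ?zd
  proof (intro ballI subset_antisym subsetI)
    fix f g assume f: "f \<in> carrier R" and g: "g \<in> carrier R"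
    show "a \<in> annihilator R (f \<otimes> g)" if sum: "a \<in> annihilator R f <+>\<^bsub>R\<^esub> annihilator R g" for a
    proof -
      obtain u v where a: "a = u \<oplus> v" and u: "u \<in> carrier R" "u \<otimes> f = \<zero>" and v: "v \<in> carrier R" "v \<otimes> g = \<zero>"
        using sum by (auto simp: set_add_def' annihilator_def)
      have "u \<otimes> (f \<otimes> g) = (u \<otimes> f) \<otimes> g" "v \<otimes> (f \<otimes> g) = f \<otimes> (v \<otimes> g)"
        using u(1) v(1) f g by (simp_all add: m_ac)
      then show ?thesis
        using u v f g by (simp add: a annihilator_def l_distr)
    qed
    show "a \<in> annihilator R f <+>\<^bsub>R\<^esub> annihilator R g" if "a \<in> annihilator R (f \<otimes> g)" for a
    proof -
      have a: "a \<in> carrier R" "(a \<otimes> f) \<otimes> g = \<zero>"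
        using that f g by (auto simp: annihilator_def m_assoc)
      then have "annihilator R (a \<otimes> f) <+> annihilator R g = carrier R"
        using \<open>?zd\<close> f g by simp
      then obtain v where v: "v \<in> annihilator R g" "v \<otimes> (a \<otimes> f) = a \<otimes> f"
        using comaximal_annihilator_iff[OF _ annihilator_ideal[OF g], of "a \<otimes> f"] a f by auto
      have vR: "v \<in> carrier R" and vg: "v \<otimes> g = \<zero>"
        using v(1) by (auto simp: annihilator_def)
      have "a \<otimes> v \<in> annihilator R g"
        using a vR vg g by (simp add: annihilator_def m_assoc)
      moreover have "(a \<ominus> a \<otimes> v) \<otimes> f = a \<otimes> f \<ominus> v \<otimes> (a \<otimes> f)"
        using a(1) vR f by (simp add: a_minus_def l_distr r_distr l_minus r_minus m_ac)
      then have "a \<ominus> a \<otimes> v \<in> annihilator R f"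
        using v(2) a(1) vR f by (simp add: annihilator_def a_minus_def r_neg)
      moreover have "a = (a \<ominus> a \<otimes> v) \<oplus> a \<otimes> v"
        using a vR by (simp add: a_minus_def a_assoc l_neg)
      ultimately show ?thesis
        unfolding set_add_def' by blast
    qed
  qed
qed

end

section \<open>Existence of prime ideals\<close>

context cring
begin

text \<open>Zorn's lemma for ideals. With \<open>S = {\<one>}\<close> it yields maximal ideals, with \<open>S\<close> multiplicatively closed
  it yields prime ideals.\<close>

lemma exists_ideal_maximal_disjoint:
  assumes I: "ideal I R" and disj: "I \<inter> S = {}"
  obtains P where "ideal P R" "I \<subseteq> P" "P \<inter> S = {}"
    "\<And>J. ideal J R \<Longrightarrow> P \<subseteq> J \<Longrightarrow> J \<inter> S = {} \<Longrightarrow> J = P"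
proof -
  define \<A> where "\<A> = {J. ideal J R \<and> I \<subseteq> J \<and> J \<inter> S = {}}"
  have "\<exists>P\<in>\<A>. \<forall>J\<in>\<A>. P \<subseteq> J \<longrightarrow> J = P"
  proof (rule subset_Zorn_nonempty)
    show "\<A> \<noteq> {}"
      using assms by (auto simp: \<A>_def)
    fix \<C> assume \<C>: "\<C> \<noteq> {}" "subset.chain \<A> \<C>"
    then have "subset.chain {J. ideal J R} \<C>"
      by (auto simp: subset.chain_def \<A>_def)
    from chain_Union_is_ideal[OF this] show "\<Union>\<C> \<in> \<A>"
      using \<C> by (auto simp: subset.chain_def \<A>_def)
  qed
  then obtain P where "P \<in> \<A>" "\<And>J. J \<in> \<A> \<Longrightarrow> P \<subseteq> J \<Longrightarrow> J = P"
    by blast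
  then show thesis
    using that[of P] unfolding \<A>_def by blast
qed

lemma exists_maximalideal_superset:
  assumes I: "ideal I R" and "I \<noteq> carrier R"
  obtains M where "maximalideal M R" "I \<subseteq> M"
proof -
  have "\<one> \<notin> I"
    using ideal.one_imp_carrier[OF I] assms(2) by blast
  then obtain M where M: "ideal M R" "I \<subseteq> M" "\<one> \<notin> M"
    and max: "\<And>J. ideal J R \<Longrightarrow> M \<subseteq> J \<Longrightarrow> \<one> \<notin> J \<Longrightarrow> J = M"
    using exists_ideal_maximal_disjoint[OF I, of "{\<one>}"] by auto
  have "maximalideal M R"
  proof (rule maximalidealI[OF M(1)])
    show "carrier R \<noteq> M"
      using M(3) by blast
    show "J = M \<or> J = carrier R" if "ideal J R" "M \<subseteq> J" "J \<subseteq> carrier R" for J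
      using max[OF that(1,2)] ideal.one_imp_carrier[OF that(1)] by blast
  qed
  then show thesis
    using that M by blast
qed

text \<open>A proper ideal lies in a maximal one, so comaximality can be tested at the maximal ideals, that is,
  on localizations.\<close>

lemma comaximalI:
  assumes I: "ideal I R" and J: "ideal J R"
    and no_max: "\<And>M. maximalideal M R \<Longrightarrow> I \<subseteq> M \<Longrightarrow> J \<subseteq> M \<Longrightarrow> False"
  shows "I <+> J = carrier R"
proof (rule ccontr)
  assume "I <+> J \<noteq> carrier R"
  then obtain M where "maximalideal M R" "I <+>\<^bsub>R\<^esub> J \<subseteq> M"
    using exists_maximalideal_superset[OF add_ideals[OF I J]] by blast
  then show False
    using no_max add_ideals_superset[OF I J] by blast
qed

text \<open>An ideal \<open>P\<close> that is maximal among those missing \<open>S\<close> is prime: if \<open>a\<close> and \<open>b\<close> are outside \<open>P\<close>,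
  then \<open>P + (a)\<close> and \<open>P + (b)\<close> both meet \<open>S\<close>, hence so does their product, which lies in
  \<open>P + (a b)\<close>; so \<open>a b \<notin> P\<close>.\<close>

lemma exists_primeideal_avoiding:
  assumes one: "\<one> \<in> S" and mult: "\<And>s t. s \<in> S \<Longrightarrow> t \<in> S \<Longrightarrow> s \<otimes> t \<in> S" and zero: "\<zero> \<notin> S"
  obtains P where "primeideal P R" "P \<inter> S = {}"
proof -
  obtain P where P: "ideal P R" "P \<inter> S = {}"
    and max: "\<And>J. ideal J R \<Longrightarrow> P \<subseteq> J \<Longrightarrow> J \<inter> S = {} \<Longrightarrow> J = P"
    by (rule exists_ideal_maximal_disjoint[OF zeroideal, of S]) (use zero in auto)
  interpret P: ideal P R by (rule P(1))
  have meets: "\<exists>p \<in> P. \<exists>r \<in> carrier R. p \<oplus> r \<otimes> a \<in> S" if a: "a \<in> carrier R" "a \<notin> P" for a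
  proof -
    have A: "ideal (PIdl a) R"
      by (rule cgenideal_ideal[OF a(1)])
    have "a \<in> P <+> PIdl a"
      using add_ideals_superset(2)[OF P(1) A] cgenideal_self[OF a(1)] by blast
    then have "(P <+> PIdl a) \<inter> S \<noteq> {}"
      using max[OF add_ideals[OF P(1) A]] add_ideals_superset(1)[OF P(1) A] a(2) by blast
    then show ?thesis
      by (auto simp: set_add_def' cgenideal_def)
  qed
  have "primeideal P R"
  proof (rule primeidealI[OF P(1) is_cring])
    show "carrier R \<noteq> P"
      using one P(2) by auto
    fix a b assume a: "a \<in> carrier R" and b: "b \<in> carrier R" and ab: "a \<otimes> b \<in> P"
    show "a \<in> P \<or> b \<in> P"
    proof (rule ccontr)
      assume "\<not> (a \<in> P \<or> b \<in> P)"
      then obtain p r q t where p: "p \<in> P" "r \<in> carrier R" "p \<oplus> r \<otimes> a \<in> S"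
        and q: "q \<in> P" "t \<in> carrier R" "q \<oplus> t \<otimes> b \<in> S"
        using meets[OF a] meets[OF b] by blast
      have "(p \<oplus> r \<otimes> a) \<otimes> (q \<oplus> t \<otimes> b) = p \<otimes> (q \<oplus> t \<otimes> b) \<oplus> ((r \<otimes> a) \<otimes> q \<oplus> (r \<otimes> t) \<otimes> (a \<otimes> b))"
        using p(2) q(2) a b P.Icarr[OF p(1)] P.Icarr[OF q(1)] by (simp add: l_distr r_distr m_ac a_ac)
      also have "\<dots> \<in> P"
        using p(1,2) q(1,2) a b ab P.Icarr[OF q(1)]
        by (intro P.a_closed[OF P.I_r_closed[OF p(1)] P.a_closed[OF P.I_l_closed[OF q(1)] P.I_l_closed[OF ab]]])
          auto
      finally show False
        using mult[OF p(3) q(3)] P(2) by blast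
    qed
  qed
  then show thesis
    using that P(2) by blast
qed

text \<open>The intersection of a chain of prime ideals is prime. Zorn's lemma for inclusion produces maximal
  elements, so it is applied to the complements of the primes below \<open>Q\<close>.\<close>

lemma exists_minimal_primeideal:
  assumes Q: "primeideal Q R"
  obtains P where "minimal_primeideal P R" "P \<subseteq> Q"
proof -
  define \<A> where "\<A> = {carrier R - P | P. primeideal P R \<and> P \<subseteq> Q}"
  have sub: "P \<subseteq> carrier R" if "primeideal P R" for P
    using that by (meson additive_subgroup.a_subset ideal.axioms(1) primeideal.axioms(1))
  have "\<exists>U\<in>\<A>. \<forall>V\<in>\<A>. U \<subseteq> V \<longrightarrow> V = U"
  proof (rule subset_Zorn_nonempty)
    show "\<A> \<noteq> {}"
      using Q by (auto simp: \<A>_def)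
    fix \<C> assume ne: "\<C> \<noteq> {}" and chain: "subset.chain \<A> \<C>"
    define \<D> where "\<D> = (\<lambda>U. carrier R - U) ` \<C>"
    have \<D>: "primeideal P R \<and> P \<subseteq> Q" if "P \<in> \<D>" for P
    proof -
      obtain U where "U \<in> \<C>" "P = carrier R - U"
        using \<open>P \<in> \<D>\<close> by (auto simp: \<D>_def)
      moreover then obtain P' where "U = carrier R - P'" "primeideal P' R" "P' \<subseteq> Q"
        using chain by (auto simp: subset.chain_def \<A>_def)
      ultimately show ?thesis
        using sub[of P'] by (simp add: double_diff)
    qed
    have \<D>_chain: "P \<subseteq> P' \<or> P' \<subseteq> P" if "P \<in> \<D>" "P' \<in> \<D>" for P P'
      using that chain unfolding \<D>_def subset.chain_def by blast
    have \<D>_ne: "\<D> \<noteq> {}"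
      using ne by (simp add: \<D>_def)
    have "primeideal (\<Inter>\<D>) R"
    proof (rule primeidealI[OF _ is_cring])
      show "ideal (\<Inter>\<D>) R"
        using \<D> \<D>_ne by (intro i_Intersect) (auto dest: primeideal.axioms(1))
      show "carrier R \<noteq> \<Inter>\<D>"
        using \<D> \<D>_ne sub primeideal.I_notcarr by fast
      fix a b assume ab: "a \<in> carrier R" "b \<in> carrier R" "a \<otimes> b \<in> \<Inter>\<D>"
      show "a \<in> \<Inter>\<D> \<or> b \<in> \<Inter>\<D>"
      proof (rule ccontr)
        assume "\<not> (a \<in> \<Inter>\<D> \<or> b \<in> \<Inter>\<D>)"
        then obtain P P' where "P \<in> \<D>" "a \<notin> P" "P' \<in> \<D>" "b \<notin> P'"
          by blast
        then obtain P'' where "P'' \<in> \<D>" "a \<notin> P''" "b \<notin> P''"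
          using \<D>_chain by blast
        then show False
          using \<D> ab primeideal.I_prime by fastforce
      qed
    qed
    moreover have "\<Inter>\<D> \<subseteq> Q"
      using \<D> \<D>_ne by blast
    moreover have "\<Union>\<C> = carrier R - \<Inter>\<D>"
    proof -
      have "U \<subseteq> carrier R" if "U \<in> \<C>" for U
        using that chain by (auto simp: subset.chain_def \<A>_def)
      then show ?thesis
        unfolding \<D>_def by blast
    qed
    ultimately show "\<Union>\<C> \<in> \<A>"
      unfolding \<A>_def by blast
  qed
  then obtain U where U: "U \<in> \<A>" and U_max: "\<And>V. V \<in> \<A> \<Longrightarrow> U \<subseteq> V \<Longrightarrow> V = U"
    by blast
  from U obtain P where P: "primeideal P R" "P \<subseteq> Q" and U_eq: "U = carrier R - P"
    by (auto simp: \<A>_def)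
  have "minimal_primeideal P R"
    unfolding minimal_primeideal_def
  proof (intro conjI P(1) allI impI, elim conjE)
    fix P' assume P': "primeideal P' R" "P' \<subseteq> P"
    have "carrier R - P' = carrier R - P"
      unfolding U_eq[symmetric]
    proof (rule U_max)
      show "carrier R - P' \<in> \<A>"
        using P' P(2) unfolding \<A>_def by blast
      show "U \<subseteq> carrier R - P'"
        using P'(2) unfolding U_eq by blast
    qed
    then show "P' = P"
      using double_diff[OF sub[OF P(1)] order_refl] double_diff[OF sub[OF P'(1)] order_refl]
      by simp
  qed
  then show thesis
    using that P(2) by blast
qed

end

section \<open>Tensor products of modules\<close>

lemma keys_diff_subset: "Poly_Mapping.keys a \<subseteq> S \<Longrightarrow> Poly_Mapping.keys b \<subseteq> S \<Longrightarrow> Poly_Mapping.keys (a - b) \<subseteq> S"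
  for a b :: "'c \<Rightarrow>\<^sub>0 int"
  using keys_diff[of a b] by blast

lemma keys_add_subset: "Poly_Mapping.keys a \<subseteq> S \<Longrightarrow> Poly_Mapping.keys b \<subseteq> S \<Longrightarrow> Poly_Mapping.keys (a + b) \<subseteq> S"
  for a b :: "'c \<Rightarrow>\<^sub>0 int"
  using keys_add[of a b] by blast

text \<open>\<open>T\<close> is the subgroup of relations in the group \<open>F\<close> of formal sums. The tensor \<open>x \<otimes> y\<close> is the
  coset of \<open>frag_of (x, y)\<close>, so membership of a formal sum in \<open>T\<close> says that the corresponding
  combination of tensors is zero.\<close>

locale module_pair = N: module R N + M: module R M
  for R (structure) and N (structure) and M (structure)
begin

abbreviation "F \<equiv> free_Abelian_group (carrier N \<times> carrier M)"
abbreviation "T \<equiv> tensor_subgroup R N M"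

lemma tensor_relators_closed: "tensor_relators R N M \<subseteq> carrier F"
proof
  fix r assume "r \<in> tensor_relators R N M"
  then show "r \<in> carrier F"
    unfolding tensor_relators_def carrier_free_Abelian_group_iff
    by (elim UnE CollectE exE conjE; hypsubst; intro keys_diff_subset keys_add_subset; simp)
qed

lemma tensor_subgroup_subgroup: "subgroup T F"
  unfolding tensor_subgroup_def
  by (rule group.generate_is_subgroup[OF group_free_Abelian_group tensor_relators_closed])

lemma tensor_subgroup_keys: "c \<in> T \<Longrightarrow> Poly_Mapping.keys c \<subseteq> carrier N \<times> carrier M"
  using subsetD[OF subgroup.subset[OF tensor_subgroup_subgroup]] by simp

lemma tensor_subgroup_zero: "0 \<in> T"
  using subgroup.one_closed[OF tensor_subgroup_subgroup] by simp

lemma tensor_subgroup_add: "a \<in> T \<Longrightarrow> b \<in> T \<Longrightarrow> a + b \<in> T"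
  using subgroup.m_closed[OF tensor_subgroup_subgroup] by simp

lemma tensor_subgroup_uminus: "a \<in> T \<Longrightarrow> - a \<in> T"
  using subgroup.m_inv_closed[OF tensor_subgroup_subgroup, of a] tensor_subgroup_keys by simp

lemma tensor_subgroup_diff: "a \<in> T \<Longrightarrow> b \<in> T \<Longrightarrow> a - b \<in> T"
  using tensor_subgroup_add[OF _ tensor_subgroup_uminus, of a b] by simp

lemma tensor_add_left:
  "x \<in> carrier N \<Longrightarrow> x' \<in> carrier N \<Longrightarrow> y \<in> carrier M \<Longrightarrow>
    frag_of (x \<oplus>\<^bsub>N\<^esub> x', y) - (frag_of (x, y) + frag_of (x', y)) \<in> T"
  unfolding tensor_subgroup_def by (rule generate.incl) (auto simp: tensor_relators_def)

lemma tensor_add_right: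
  "x \<in> carrier N \<Longrightarrow> y \<in> carrier M \<Longrightarrow> y' \<in> carrier M \<Longrightarrow>
    frag_of (x, y \<oplus>\<^bsub>M\<^esub> y') - (frag_of (x, y) + frag_of (x, y')) \<in> T"
  unfolding tensor_subgroup_def by (rule generate.incl) (auto simp: tensor_relators_def)

lemma tensor_smult:
  "a \<in> carrier R \<Longrightarrow> x \<in> carrier N \<Longrightarrow> y \<in> carrier M \<Longrightarrow>
    frag_of (a \<odot>\<^bsub>N\<^esub> x, y) - frag_of (x, a \<odot>\<^bsub>M\<^esub> y) \<in> T"
  unfolding tensor_subgroup_def by (rule generate.incl) (auto simp: tensor_relators_def)

lemma tensor_zero_right:
  assumes "x \<in> carrier N"
  shows "frag_of (x, \<zero>\<^bsub>M\<^esub>) \<in> T"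
proof -
  have "- frag_of (x, \<zero>\<^bsub>M\<^esub>) \<in> T"
    using tensor_add_right[OF assms M.M.zero_closed M.M.zero_closed] by simp
  then show ?thesis
    using tensor_subgroup_uminus by fastforce
qed

lemma tensor_zero_left:
  assumes "y \<in> carrier M"
  shows "frag_of (\<zero>\<^bsub>N\<^esub>, y) \<in> T"
proof -
  have "- frag_of (\<zero>\<^bsub>N\<^esub>, y) \<in> T"
    using tensor_add_left[OF N.M.zero_closed N.M.zero_closed assms] by simp
  then show ?thesis
    using tensor_subgroup_uminus by fastforce
qed

lemma tensor_diff_left:
  assumes "x \<in> carrier N" "x' \<in> carrier N" "y \<in> carrier M"
  shows "frag_of (x \<ominus>\<^bsub>N\<^esub> x', y) - (frag_of (x, y) - frag_of (x', y)) \<in> T"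
proof -
  have "(x \<ominus>\<^bsub>N\<^esub> x') \<oplus>\<^bsub>N\<^esub> x' = x"
    using assms by (simp add: a_minus_def N.M.a_assoc N.M.l_neg)
  then have "frag_of (x, y) - (frag_of (x \<ominus>\<^bsub>N\<^esub> x', y) + frag_of (x', y)) \<in> T"
    using tensor_add_left[of "x \<ominus>\<^bsub>N\<^esub> x'" x' y] assms by simp
  from tensor_subgroup_uminus[OF this] show ?thesis
    by (simp add: algebra_simps)
qed

lemma tensor_coset_mem_iff: "z \<in> T #>\<^bsub>F\<^esub> c \<longleftrightarrow> z - c \<in> T"
proof -
  have "z = t + c \<longleftrightarrow> z - c = t" for t
    by auto
  then show ?thesis
    by (auto simp: r_coset_def)
qed

lemma tensor_coset_eq_iff: "T #>\<^bsub>F\<^esub> c = T #>\<^bsub>F\<^esub> d \<longleftrightarrow> c - d \<in> T"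
proof
  assume "T #>\<^bsub>F\<^esub> c = T #>\<^bsub>F\<^esub> d"
  moreover have "c \<in> T #>\<^bsub>F\<^esub> c"
    by (simp add: tensor_coset_mem_iff tensor_subgroup_zero)
  ultimately show "c - d \<in> T"
    by (simp add: tensor_coset_mem_iff)
next
  assume cd: "c - d \<in> T"
  have "z - c \<in> T \<longleftrightarrow> z - d \<in> T" for z
    using tensor_subgroup_add[OF _ cd, of "z - c"] tensor_subgroup_diff[OF _ cd, of "z - d"] by auto
  then show "T #>\<^bsub>F\<^esub> c = T #>\<^bsub>F\<^esub> d"
    by (auto simp: tensor_coset_mem_iff)
qed

text \<open>The part of the universal property of the tensor product that serves as a test for being nonzero: a
  balanced map \<open>\<beta>\<close> extends to a homomorphism on formal sums that kills every relator, so a pure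
  tensor that is zero is sent to the neutral element.\<close>

lemma balanced_map_kills_relations:
  assumes G: "comm_group G"
    and \<beta>: "\<And>x y. x \<in> carrier N \<Longrightarrow> y \<in> carrier M \<Longrightarrow> \<beta> x y \<in> carrier G"
    and add_left: "\<And>x x' y. x \<in> carrier N \<Longrightarrow> x' \<in> carrier N \<Longrightarrow> y \<in> carrier M \<Longrightarrow>
        \<beta> (x \<oplus>\<^bsub>N\<^esub> x') y = \<beta> x y \<otimes>\<^bsub>G\<^esub> \<beta> x' y"
    and add_right: "\<And>x y y'. x \<in> carrier N \<Longrightarrow> y \<in> carrier M \<Longrightarrow> y' \<in> carrier M \<Longrightarrow>
        \<beta> x (y \<oplus>\<^bsub>M\<^esub> y') = \<beta> x y \<otimes>\<^bsub>G\<^esub> \<beta> x y'"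
    and smult: "\<And>a x y. a \<in> carrier R \<Longrightarrow> x \<in> carrier N \<Longrightarrow> y \<in> carrier M \<Longrightarrow>
        \<beta> (a \<odot>\<^bsub>N\<^esub> x) y = \<beta> x (a \<odot>\<^bsub>M\<^esub> y)"
    and x: "x \<in> carrier N" and y: "y \<in> carrier M" and T: "frag_of (x, y) \<in> T"
  shows "\<beta> x y = \<one>\<^bsub>G\<^esub>"
proof -
  interpret G: comm_group G by (rule G)
  have "(\<lambda>(x, y). \<beta> x y) ` (carrier N \<times> carrier M) \<subseteq> carrier G"
    using \<beta> by auto
  then obtain h where h: "h \<in> hom F G"
    and h_frag: "\<And>p. p \<in> carrier N \<times> carrier M \<Longrightarrow> h (frag_of p) = (\<lambda>(x, y). \<beta> x y) p"
    using G.free_Abelian_group_universal by blast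
  interpret h: group_hom F G h
    by (simp add: h group_hom_def group_hom_axioms_def G.is_group)
  have h_add: "h (a + b) = h a \<otimes>\<^bsub>G\<^esub> h b" if "a \<in> carrier F" "b \<in> carrier F" for a b
    using h.hom_mult[OF that] by simp
  have h_diff: "h (a - b) = h a \<otimes>\<^bsub>G\<^esub> inv\<^bsub>G\<^esub> h b" if "a \<in> carrier F" "b \<in> carrier F" for a b
    using h_add[OF that(1), of "- b"] h.hom_inv[OF that(2)] that by simp
  have "h r = \<one>\<^bsub>G\<^esub>" if "r \<in> tensor_relators R N M" for r
    using that unfolding tensor_relators_def
    by (auto simp: h_frag h_diff h_add keys_add_subset add_left add_right smult \<beta>)
  then have "tensor_relators R N M \<subseteq> kernel F G h"
    using tensor_relators_closed by (auto simp: kernel_def simp del: carrier_free_Abelian_group_iff)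
  then have "T \<subseteq> kernel F G h"
    unfolding tensor_subgroup_def
    by (intro h.G.generate_subgroup_incl h.subgroup_kernel)
  with T have "h (frag_of (x, y)) = \<one>\<^bsub>G\<^esub>"
    by (auto simp: kernel_def)
  then show ?thesis
    using h_frag x y by simp
qed

end

lemma module_homD:
  assumes "f \<in> module_hom R N N'"
  shows "x \<in> carrier N \<Longrightarrow> f x \<in> carrier N'"
    and "x \<in> carrier N \<Longrightarrow> y \<in> carrier N \<Longrightarrow> f (x \<oplus>\<^bsub>N\<^esub> y) = f x \<oplus>\<^bsub>N'\<^esub> f y"
    and "a \<in> carrier R \<Longrightarrow> x \<in> carrier N \<Longrightarrow> f (a \<odot>\<^bsub>N\<^esub> x) = a \<odot>\<^bsub>N'\<^esub> f x"
  using assms by (auto simp: module_hom_def)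

locale tensor_hom = N: module_pair R N M + N': module_pair R N' M
  for R (structure) and N (structure) and N' (structure) and M (structure) +
  fixes f
  assumes f: "f \<in> module_hom R N N'"
begin

abbreviation "ext \<equiv> frag_extend (\<lambda>(x, y). frag_of (f x, y))"

lemma ext_tensor_subgroup:
  assumes "c \<in> N.T"
  shows "ext c \<in> N'.T"
proof -
  have rel: "ext r \<in> N'.T" if "r \<in> tensor_relators R N M" for r
    using that unfolding tensor_relators_def
    by (auto simp: frag_extend_diff frag_extend_add module_homD[OF f]
        intro!: N'.tensor_add_left N'.tensor_add_right N'.tensor_smult)
  show ?thesis
    using assms unfolding tensor_subgroup_def[of R N M]
  proof induction
    case (inv r)
    then have "Poly_Mapping.keys r \<subseteq> carrier N \<times> carrier M"
      using subsetD[OF N.tensor_relators_closed] by simp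
    then show ?case
      using rel[OF inv] by (simp add: frag_extend_minus N'.tensor_subgroup_uminus)
  qed (auto simp: rel frag_extend_add N'.tensor_subgroup_zero N'.tensor_subgroup_add)
qed

lemma tensor_map_coset: "tensor_map R N' M f (N.T #>\<^bsub>N.F\<^esub> c) = N'.T #>\<^bsub>N'.F\<^esub> ext c"
proof -
  have "N'.T #>\<^bsub>N'.F\<^esub> ext (t + c) = N'.T #>\<^bsub>N'.F\<^esub> ext c" if "t \<in> N.T" for t
    using ext_tensor_subgroup[OF that]
    by (simp add: N'.tensor_coset_eq_iff frag_extend_add)
  moreover have "N.T \<noteq> {}"
    using N.tensor_subgroup_zero by blast
  ultimately show ?thesis
    by (auto simp: tensor_map_def r_coset_def[of N.F])
qed

text \<open>Injectivity of the map on tensor products is a statement about cosets; this restates it as a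
  trivial kernel, on representing formal sums.\<close>

lemma tensor_map_inj_iff:
  "inj_on (tensor_map R N' M f) (carrier (tensor_product R N M)) \<longleftrightarrow>
    (\<forall>c. Poly_Mapping.keys c \<subseteq> carrier N \<times> carrier M \<and> ext c \<in> N'.T \<longrightarrow> c \<in> N.T)"
  (is "?inj \<longleftrightarrow> ?ker")
proof
  have carr: "carrier (tensor_product R N M) =
      (\<lambda>c. N.T #>\<^bsub>N.F\<^esub> c) ` {c. Poly_Mapping.keys c \<subseteq> carrier N \<times> carrier M}"
    by (auto simp: tensor_product_def FactGroup_def RCOSETS_def)
  show ?ker if ?inj
  proof (intro allI impI, elim conjE)
    fix c assume c: "Poly_Mapping.keys c \<subseteq> carrier N \<times> carrier M" and "ext c \<in> N'.T"
    then have "tensor_map R N' M f (N.T #>\<^bsub>N.F\<^esub> c) = tensor_map R N' M f (N.T #>\<^bsub>N.F\<^esub> 0)"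
      by (simp add: tensor_map_coset N'.tensor_coset_eq_iff)
    then have "N.T #>\<^bsub>N.F\<^esub> c = N.T #>\<^bsub>N.F\<^esub> 0"
      by (rule inj_onD[OF that]) (use c in \<open>auto simp: carr\<close>)
    then show "c \<in> N.T"
      by (simp add: N.tensor_coset_eq_iff)
  qed
  show ?inj if ?ker
  proof (rule inj_onI, unfold carr, elim imageE, clarsimp)
    fix c d assume keys: "Poly_Mapping.keys c \<subseteq> carrier N \<times> carrier M"
        "Poly_Mapping.keys d \<subseteq> carrier N \<times> carrier M"
      and "tensor_map R N' M f (N.T #>\<^bsub>N.F\<^esub> c) = tensor_map R N' M f (N.T #>\<^bsub>N.F\<^esub> d)"
    then have "ext (c - d) \<in> N'.T"
      by (simp add: tensor_map_coset N'.tensor_coset_eq_iff frag_extend_diff)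
    then have "c - d \<in> N.T"
      using that keys_diff_subset[OF keys] by blast
    then show "N.T #>\<^bsub>N.F\<^esub> c = N.T #>\<^bsub>N.F\<^esub> d"
      by (simp add: N.tensor_coset_eq_iff)
  qed
qed

end

section \<open>Flatness of cyclic modules\<close>

lemma (in abelian_group) minus_eq_zero_iff:
  assumes "a \<in> carrier G" "b \<in> carrier G"
  shows "a \<ominus> b = \<zero> \<longleftrightarrow> a = b"
proof
  assume "a \<ominus> b = \<zero>"
  then have "(a \<ominus> b) \<oplus> b = b"
    using assms by simp
  then show "a = b"
    using assms by (simp add: a_minus_def a_assoc l_neg)
qed (use assms in \<open>simp add: a_minus_def r_neg\<close>)

text \<open>Both modules whose flatness is at stake are cyclic: \<open>R / I\<close> is generated by the class of \<open>\<one>\<close>, whose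
  annihilator is \<open>I\<close>, and a principal ideal is generated by \<open>f\<close>, whose annihilator is \<open>Ann f\<close>.\<close>

locale cyclic_module = module R M for R (structure) and M (structure) +
  fixes e
  assumes e_closed: "e \<in> carrier M"
    and generated: "\<And>y. y \<in> carrier M \<Longrightarrow> \<exists>a \<in> carrier R. y = a \<odot>\<^bsub>M\<^esub> e"
begin

definition Ann where "Ann = {a \<in> carrier R. a \<odot>\<^bsub>M\<^esub> e = \<zero>\<^bsub>M\<^esub>}"

lemma zero_in_Ann: "\<zero> \<in> Ann"
  using e_closed by (simp add: Ann_def)

lemma same_multiple_iff:
  assumes "a \<in> carrier R" "b \<in> carrier R"
  shows "a \<odot>\<^bsub>M\<^esub> e = b \<odot>\<^bsub>M\<^esub> e \<longleftrightarrow> a \<ominus> b \<in> Ann"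
proof -
  have "(a \<ominus> b) \<odot>\<^bsub>M\<^esub> e = a \<odot>\<^bsub>M\<^esub> e \<ominus>\<^bsub>M\<^esub> b \<odot>\<^bsub>M\<^esub> e"
    using assms e_closed by (simp add: a_minus_def smult_l_distr smult_l_minus)
  then show ?thesis
    using assms e_closed by (simp add: Ann_def M.minus_eq_zero_iff)
qed

text \<open>Since \<open>M\<close> is isomorphic to \<open>R / Ann\<close>, the product \<open>N \<otimes> M\<close> maps onto \<open>N / K\<close> for every \<open>K\<close> containing
  \<open>Ann N\<close>, by sending \<open>n \<otimes> a e\<close> to the class of \<open>a n\<close>. In
  particular \<open>x \<otimes> e\<close> goes to the class of \<open>x\<close>.\<close>

lemma tensor_generator_zero_imp:
  assumes N: "module R N" and K: "additive_subgroup K N"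
    and Ann_smult: "\<And>a n. a \<in> Ann \<Longrightarrow> n \<in> carrier N \<Longrightarrow> a \<odot>\<^bsub>N\<^esub> n \<in> K"
    and x: "x \<in> carrier N" and T: "frag_of (x, e) \<in> tensor_subgroup R N M"
  shows "x \<in> K"
proof -
  interpret N: module R N by (rule N)
  interpret MP: module_pair R N M by unfold_locales
  interpret K: abelian_subgroup K N
    by (rule abelian_subgroupI3[OF K N.M.abelian_group_axioms])
  \<comment> \<open>Coefficients are chosen; two choices for the same \<open>y\<close> differ by an element of \<open>Ann\<close>.\<close>
  define coef where "coef y = (SOME a. a \<in> carrier R \<and> y = a \<odot>\<^bsub>M\<^esub> e)" for y
  have coef: "coef y \<in> carrier R" "coef y \<odot>\<^bsub>M\<^esub> e = y" if "y \<in> carrier M" for y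
    using someI_ex[of "\<lambda>a. a \<in> carrier R \<and> y = a \<odot>\<^bsub>M\<^esub> e"] generated[OF that]
    unfolding coef_def by (blast, metis)
  define \<beta> where "\<beta> n y = K +>\<^bsub>N\<^esub> (coef y \<odot>\<^bsub>N\<^esub> n)" for n y
  have \<beta>: "\<beta> n y = K +>\<^bsub>N\<^esub> (a \<odot>\<^bsub>N\<^esub> n)"
    if "n \<in> carrier N" "y \<in> carrier M" "a \<in> carrier R" "y = a \<odot>\<^bsub>M\<^esub> e" for n y a
  proof -
    have "a \<ominus> coef y \<in> Ann"
      using same_multiple_iff coef that by metis
    then have "(a \<ominus> coef y) \<odot>\<^bsub>N\<^esub> n \<in> K"
      using Ann_smult that by blast
    then have "a \<odot>\<^bsub>N\<^esub> n \<oplus>\<^bsub>N\<^esub> \<ominus>\<^bsub>N\<^esub> (coef y \<odot>\<^bsub>N\<^esub> n) \<in> K"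
      using that coef by (simp add: a_minus_def N.smult_l_distr N.smult_l_minus)
    then show ?thesis
      unfolding \<beta>_def using that coef
      by (intro K.a_repr_independence') (simp_all add: K.a_rcos_module)
  qed
  have "\<beta> x e = \<one>\<^bsub>N A_Mod K\<^esub>"
  proof (rule MP.balanced_map_kills_relations[OF K.a_factorgroup_is_comm_group _ _ _ _ x e_closed T])
    show "\<beta> n y \<in> carrier (N A_Mod K)" if "n \<in> carrier N" "y \<in> carrier M" for n y
      using that coef by (auto simp: \<beta>_def A_FactGroup_def' A_RCOSETS_def')
    show "\<beta> (n \<oplus>\<^bsub>N\<^esub> n') y = \<beta> n y \<otimes>\<^bsub>N A_Mod K\<^esub> \<beta> n' y"
      if "n \<in> carrier N" "n' \<in> carrier N" "y \<in> carrier M" for n n' y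
      using that coef by (simp add: \<beta>_def N.smult_r_distr K.a_rcos_sum)
    show "\<beta> n (y \<oplus>\<^bsub>M\<^esub> y') = \<beta> n y \<otimes>\<^bsub>N A_Mod K\<^esub> \<beta> n y'"
      if "n \<in> carrier N" "y \<in> carrier M" "y' \<in> carrier M" for n y y'
      using that coef e_closed
      by (simp add: \<beta>[of n "y \<oplus>\<^bsub>M\<^esub> y'" "coef y \<oplus> coef y'"] smult_l_distr N.smult_l_distr
          \<beta>_def[of n y] \<beta>_def[of n y'] K.a_rcos_sum)
    show "\<beta> (a \<odot>\<^bsub>N\<^esub> n) y = \<beta> n (a \<odot>\<^bsub>M\<^esub> y)"
      if "a \<in> carrier R" "n \<in> carrier N" "y \<in> carrier M" for a n y
    proof -
      have "coef y \<odot>\<^bsub>N\<^esub> (a \<odot>\<^bsub>N\<^esub> n) = (a \<otimes> coef y) \<odot>\<^bsub>N\<^esub> n"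
        using that coef by (simp add: N.smult_assoc1[symmetric] R.m_comm)
      then show ?thesis
        using that coef e_closed
        by (simp add: \<beta>[of n "a \<odot>\<^bsub>M\<^esub> y" "a \<otimes> coef y"] smult_assoc1 \<beta>_def[of "a \<odot>\<^bsub>N\<^esub> n"])
    qed
  qed
  moreover have "\<beta> x e = K +>\<^bsub>N\<^esub> x"
    using \<beta>[of x e \<one>] x e_closed by simp
  ultimately have "K +>\<^bsub>N\<^esub> x = K"
    by (simp add: A_FactGroup_def')
  then show ?thesis
    using K.a_rcos_self[OF x] by simp
qed

text \<open>Because \<open>n \<otimes> a e = a n \<otimes> e\<close>, coefficients move to the left factor.\<close>

lemma tensor_eq_generator_tensor:
  assumes N: "module R N" and c: "Poly_Mapping.keys c \<subseteq> carrier N \<times> carrier M"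
  shows "\<exists>n \<in> carrier N. c - frag_of (n, e) \<in> tensor_subgroup R N M"
proof -
  interpret N: module R N by (rule N)
  interpret MP: module_pair R N M by unfold_locales
  show ?thesis
    using c
  proof (induction rule: frag_induction)
    case zero
    show ?case
      using MP.tensor_subgroup_uminus[OF MP.tensor_zero_left[OF e_closed]]
      by (intro bexI[of _ "\<zero>\<^bsub>N\<^esub>"]) auto
  next
    case (one p)
    then obtain n y where p: "p = (n, y)" "n \<in> carrier N" "y \<in> carrier M" by auto
    then obtain a where a: "a \<in> carrier R" "y = a \<odot>\<^bsub>M\<^esub> e"
      using generated by blast
    have "- (frag_of (a \<odot>\<^bsub>N\<^esub> n, e) - frag_of (n, y)) \<in> MP.T"
      using MP.tensor_subgroup_uminus[OF MP.tensor_smult[OF a(1) p(2) e_closed]] a by simp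
    then show ?case
      using p a by (intro bexI[of _ "a \<odot>\<^bsub>N\<^esub> n"]) auto
  next
    case (diff c d)
    then obtain n m where n: "n \<in> carrier N" "c - frag_of (n, e) \<in> MP.T"
      and m: "m \<in> carrier N" "d - frag_of (m, e) \<in> MP.T" by auto
    have "(c - frag_of (n, e)) - (d - frag_of (m, e))
        - (frag_of (n \<ominus>\<^bsub>N\<^esub> m, e) - (frag_of (n, e) - frag_of (m, e))) \<in> MP.T"
      by (intro MP.tensor_subgroup_diff MP.tensor_diff_left n m e_closed)
    then have "c - d - frag_of (n \<ominus>\<^bsub>N\<^esub> m, e) \<in> MP.T"
      by (simp add: algebra_simps)
    then show ?case
      using n m by blast
  qed
qed

text \<open>Every element of \<open>N \<otimes> M\<close> is \<open>n \<otimes> e\<close>. The elements of \<open>N'\<close> fixed by some \<open>g \<in> Ann\<close> form a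
  subgroup \<open>K\<close> containing \<open>Ann N'\<close>. So if \<open>f n \<otimes> e = 0\<close>, then \<open>f n = g (f n) = f (g n)\<close> for some
  \<open>g \<in> Ann\<close>, hence \<open>n = g n\<close> by injectivity, and \<open>n \<otimes> e = n \<otimes> g e = 0\<close>.\<close>

lemma has_local_units_imp_flat:
  assumes "has_local_units R Ann"
  shows "flat_module TYPE('u) R M"
  unfolding flat_module_def
proof (intro conjI allI impI; (elim conjE)?)
  show "module R M"
    by (rule module_axioms)
  fix N N' :: "('a, 'u) module" and f
  assume N: "module R N" and N': "module R N'" and f: "f \<in> module_hom R N N'"
    and inj: "inj_on f (carrier N)"
  interpret N: module R N by (rule N)
  interpret N': module R N' by (rule N')
  interpret th: tensor_hom R N N' M f
    by unfold_locales (rule f)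
  show "inj_on (tensor_map R N' M f) (carrier (tensor_product R N M))"
    unfolding th.tensor_map_inj_iff
  proof (intro allI impI, elim conjE)
    fix c assume "Poly_Mapping.keys c \<subseteq> carrier N \<times> carrier M" and ext_c: "th.ext c \<in> th.N'.T"
    then obtain n where n: "n \<in> carrier N" and c: "c - frag_of (n, e) \<in> th.N.T"
      using tensor_eq_generator_tensor[OF N] by blast
    have "th.ext c - th.ext (c - frag_of (n, e)) \<in> th.N'.T"
      by (intro th.N'.tensor_subgroup_diff ext_c th.ext_tensor_subgroup c)
    then have fn_T: "frag_of (f n, e) \<in> th.N'.T"
      by (simp add: frag_extend_diff)
    define K where "K = {n' \<in> carrier N'. \<exists>g \<in> Ann. g \<odot>\<^bsub>N'\<^esub> n' = n'}"
    have "f n \<in> K"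
    proof (rule tensor_generator_zero_imp[OF N' _ _ _ fn_T])
      show "f n \<in> carrier N'"
        by (rule module_homD(1)[OF f n])
      show "a \<odot>\<^bsub>N'\<^esub> n' \<in> K" if a: "a \<in> Ann" and n': "n' \<in> carrier N'" for a n'
      proof -
        obtain g where "g \<in> Ann" "g \<otimes> a = a"
          using assms a unfolding has_local_units_def by blast
        moreover from this have "g \<odot>\<^bsub>N'\<^esub> (a \<odot>\<^bsub>N'\<^esub> n') = a \<odot>\<^bsub>N'\<^esub> n'"
          using a n' by (simp add: Ann_def N'.smult_assoc1[symmetric])
        ultimately show ?thesis
          using a n' by (auto simp: K_def Ann_def)
      qed
      show "additive_subgroup K N'"
      proof (rule additive_subgroupI, rule N'.M.add.subgroupI)
        show "K \<subseteq> carrier N'"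
          by (auto simp: K_def)
        have "\<zero>\<^bsub>N'\<^esub> \<in> K"
          using Ann_def zero_in_Ann by (auto simp: K_def)
        then show "K \<noteq> {}"
          by blast
        fix x assume x: "x \<in> K"
        then obtain g where g: "g \<in> Ann" "g \<odot>\<^bsub>N'\<^esub> x = x" "x \<in> carrier N'"
          by (auto simp: K_def)
        then show "\<ominus>\<^bsub>N'\<^esub> x \<in> K"
          by (auto simp: K_def Ann_def N'.smult_r_minus intro!: bexI[of _ g])
        fix y assume "y \<in> K"
        then obtain h where h: "h \<in> Ann" "h \<odot>\<^bsub>N'\<^esub> y = y" "y \<in> carrier N'"
          by (auto simp: K_def)
        \<comment> \<open>From \<open>\<one> - k = (\<one> - g)(\<one> - h)\<close>: \<open>k\<close> fixes whatever \<open>g\<close> or \<open>h\<close> fixes.\<close>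
        define k where "k = g \<oplus> h \<ominus> g \<otimes> h"
        have gR: "g \<in> carrier R" and hR: "h \<in> carrier R"
          using g h by (auto simp: Ann_def)
        have k: "k \<in> Ann"
          using g h gR hR e_closed
          by (simp add: k_def Ann_def a_minus_def smult_l_distr smult_l_minus smult_assoc1)
        have kz: "k \<odot>\<^bsub>N'\<^esub> z = g \<odot>\<^bsub>N'\<^esub> z \<oplus>\<^bsub>N'\<^esub> (h \<odot>\<^bsub>N'\<^esub> z \<ominus>\<^bsub>N'\<^esub> (g \<otimes> h) \<odot>\<^bsub>N'\<^esub> z)"
          if "z \<in> carrier N'" for z
          using that gR hR by (simp add: k_def a_minus_def N'.smult_l_distr N'.smult_l_minus N'.M.a_assoc)
        have "(g \<otimes> h) \<odot>\<^bsub>N'\<^esub> x = h \<odot>\<^bsub>N'\<^esub> x"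
          using g gR hR by (simp add: R.m_comm[of g h] N'.smult_assoc1)
        then have "k \<odot>\<^bsub>N'\<^esub> x = x"
          using kz[of x] g hR by (simp add: N'.M.minus_eq_zero_iff)
        moreover have "(g \<otimes> h) \<odot>\<^bsub>N'\<^esub> y = g \<odot>\<^bsub>N'\<^esub> y"
          using h gR hR by (simp add: N'.smult_assoc1)
        then have "k \<odot>\<^bsub>N'\<^esub> y = y"
          using kz[of y] h gR
          by (simp add: a_minus_def N'.M.a_lcomm[of "g \<odot>\<^bsub>N'\<^esub> y"] N'.M.r_neg)
        ultimately have "k \<odot>\<^bsub>N'\<^esub> (x \<oplus>\<^bsub>N'\<^esub> y) = x \<oplus>\<^bsub>N'\<^esub> y"
          using k g h by (simp add: Ann_def N'.smult_r_distr)
        then show "x \<oplus>\<^bsub>N'\<^esub> y \<in> K"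
          using k g h by (auto simp: K_def)
      qed
    qed
    then obtain g where g: "g \<in> Ann" "g \<odot>\<^bsub>N'\<^esub> f n = f n"
      by (auto simp: K_def)
    then have gR: "g \<in> carrier R" and ge: "g \<odot>\<^bsub>M\<^esub> e = \<zero>\<^bsub>M\<^esub>"
      by (auto simp: Ann_def)
    have "f (g \<odot>\<^bsub>N\<^esub> n) = f n"
      using g gR n by (simp add: module_homD(3)[OF f])
    then have gn: "g \<odot>\<^bsub>N\<^esub> n = n"
      using inj_onD[OF inj] gR n by auto
    have "(frag_of (g \<odot>\<^bsub>N\<^esub> n, e) - frag_of (n, g \<odot>\<^bsub>M\<^esub> e)) + frag_of (n, \<zero>\<^bsub>M\<^esub>) \<in> th.N.T"
      by (intro th.N.tensor_subgroup_add th.N.tensor_smult th.N.tensor_zero_right gR n e_closed)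
    then have "frag_of (n, e) \<in> th.N.T"
      by (simp add: gn ge)
    then show "c \<in> th.N.T"
      using th.N.tensor_subgroup_add[OF c, of "frag_of (n, e)"] by simp
  qed
qed

end

lemma ideal_module_simps [simp]:
  "carrier (ideal_module R I) = I"
  "\<zero>\<^bsub>ideal_module R I\<^esub> = \<zero>\<^bsub>R\<^esub>"
  "x \<oplus>\<^bsub>ideal_module R I\<^esub> y = x \<oplus>\<^bsub>R\<^esub> y"
  "a \<odot>\<^bsub>ideal_module R I\<^esub> x = a \<otimes>\<^bsub>R\<^esub> x"
  by (simp_all add: ideal_module_def)

lemma (in cring) module_ideal_module:
  assumes "ideal I R"
  shows "module R (ideal_module R I)"
proof -
  interpret ideal I R by (rule assms)
  show ?thesis
  proof (rule moduleI[OF is_cring], rule abelian_groupI, unfold ideal_module_simps)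
    fix x assume a: "x \<in> I"
    then have aR: "x \<in> carrier R"
      by (rule Icarr)
    show "\<zero> \<oplus> x = x" "\<one> \<otimes> x = x"
      using aR by simp_all
    show "\<exists>y\<in>I. y \<oplus> x = \<zero>"
      using a aR by (intro bexI[of _ "\<ominus> x"]) (simp_all add: l_neg)
    show "r \<otimes> x \<in> I" if "r \<in> carrier R" for r
      using a that by (rule I_l_closed)
    show "(r \<oplus> s) \<otimes> x = r \<otimes> x \<oplus> s \<otimes> x" and "(r \<otimes> s) \<otimes> x = r \<otimes> (s \<otimes> x)"
      if "r \<in> carrier R" "s \<in> carrier R" for r s
      using aR that by (simp_all add: l_distr m_assoc)
    fix y assume b: "y \<in> I"
    then have bR: "y \<in> carrier R"
      by (rule Icarr)
    show "x \<oplus> y \<in> I" and "x \<oplus> y = y \<oplus> x"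
      using a b aR bR by (simp_all add: a_comm)
    show "r \<otimes> (x \<oplus> y) = r \<otimes> x \<oplus> r \<otimes> y" if "r \<in> carrier R" for r
      using aR bR that by (simp add: r_distr)
    fix z assume "z \<in> I"
    then have "z \<in> carrier R"
      by (rule Icarr)
    then show "x \<oplus> y \<oplus> z = x \<oplus> (y \<oplus> z)"
      using aR bR by (simp add: a_assoc)
  qed simp
qed

text \<open>Flatness is tested on modules whose elements live in the type \<open>'a + 'u\<close>; the left summand has room for
  copies of the ideals of \<open>R\<close>.\<close>

definition Inl_copy :: "('a, 'b) module \<Rightarrow> ('a, 'b + 'u) module" where
  "Inl_copy M =
     \<lparr>carrier = Inl ` carrier M, monoid.mult = (\<lambda>x y. Inl (projl x \<otimes>\<^bsub>M\<^esub> projl y)),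
      monoid.one = Inl \<one>\<^bsub>M\<^esub>, ring.zero = Inl \<zero>\<^bsub>M\<^esub>,
      ring.add = (\<lambda>x y. Inl (projl x \<oplus>\<^bsub>M\<^esub> projl y)), smult = (\<lambda>a x. Inl (a \<odot>\<^bsub>M\<^esub> projl x))\<rparr>"

lemma Inl_copy_simps [simp]:
  "carrier (Inl_copy M) = Inl ` carrier M"
  "\<zero>\<^bsub>Inl_copy M\<^esub> = Inl \<zero>\<^bsub>M\<^esub>"
  "Inl x \<oplus>\<^bsub>Inl_copy M\<^esub> Inl y = Inl (x \<oplus>\<^bsub>M\<^esub> y)"
  "a \<odot>\<^bsub>Inl_copy M\<^esub> Inl x = Inl (a \<odot>\<^bsub>M\<^esub> x)"
  by (simp_all add: Inl_copy_def)

lemma module_Inl_copy: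
  assumes "module R M"
  shows "module R (Inl_copy M)"
proof -
  interpret module R M by (rule assms)
  show ?thesis
  proof (rule moduleI[OF R.is_cring], rule abelian_groupI)
    show "\<exists>y\<in>carrier (Inl_copy M). y \<oplus>\<^bsub>Inl_copy M\<^esub> x = \<zero>\<^bsub>Inl_copy M\<^esub>"
      if "x \<in> carrier (Inl_copy M)" for x
      using that by (auto simp: M.l_neg)
  qed (auto simp: M.a_assoc M.a_comm M.a_lcomm smult_l_distr smult_r_distr smult_assoc1)
qed

context cyclic_module begin

lemma Ann_ideal: "ideal Ann R"
proof (rule idealI[OF R.ring_axioms], rule R.add.subgroupI)
  show "Ann \<subseteq> carrier R"
    by (auto simp: Ann_def)
  show "Ann \<noteq> {}"
    using zero_in_Ann by blast
  show "x \<otimes> a \<in> Ann" if "a \<in> Ann" "x \<in> carrier R" for a x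
    using that e_closed by (simp add: Ann_def smult_assoc1)
  then show "a \<otimes> x \<in> Ann" if "a \<in> Ann" "x \<in> carrier R" for a x
    using that R.m_comm[of a x] by (simp add: Ann_def)
qed (use e_closed in \<open>simp_all add: Ann_def smult_l_distr smult_l_minus\<close>)

text \<open>For \<open>x \<in> Ann\<close>, test flatness on the inclusion of \<open>R x\<close> in \<open>R\<close>. In \<open>R \<otimes> M\<close> the tensor
  \<open>x \<otimes> e = \<one> \<otimes> x e\<close> is zero, so it is already zero in \<open>R x \<otimes> M\<close>; mapping this to
  \<open>R x / Ann x\<close>, the quotient by the multiples of \<open>x\<close> with factor in \<open>Ann\<close>, shows that
  \<open>x = g x\<close> with \<open>g \<in> Ann\<close>.\<close>

lemma flat_imp_has_local_units:
  assumes flat: "flat_module TYPE('a + 'u) R M"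
  shows "has_local_units R Ann"
  unfolding has_local_units_def
proof
  fix x assume "x \<in> Ann"
  then have x: "x \<in> carrier R" and xe: "x \<odot>\<^bsub>M\<^esub> e = \<zero>\<^bsub>M\<^esub>"
    by (auto simp: Ann_def)
  interpret Ann: ideal Ann R by (rule Ann_ideal)
  define N where "N = (Inl_copy (ideal_module R (PIdl x)) :: ('a, 'a + 'u) module)"
  define N' where "N' = (Inl_copy (ideal_module R (carrier R)) :: ('a, 'a + 'u) module)"
  have N: "module R N" and N': "module R N'"
    unfolding N_def N'_def by (intro module_Inl_copy R.module_ideal_module R.cgenideal_ideal x R.oneideal)+
  interpret N: module R N by (rule N)
  interpret N': module R N' by (rule N')
  have id: "id \<in> module_hom R N N'"
    using x by (auto simp: module_hom_def N_def N'_def cgenideal_def)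
  interpret th: tensor_hom R N N' M id
    by unfold_locales (rule id)
  have x_N: "Inl x \<in> carrier N"
    using R.cgenideal_self[OF x] by (simp add: N_def)
  have one_N': "Inl \<one> \<in> carrier N'"
    by (simp add: N'_def)
  have "(frag_of (x \<odot>\<^bsub>N'\<^esub> Inl \<one>, e) - frag_of (Inl \<one>, x \<odot>\<^bsub>M\<^esub> e)) + frag_of (Inl \<one>, \<zero>\<^bsub>M\<^esub>) \<in> th.N'.T"
    by (intro th.N'.tensor_subgroup_add th.N'.tensor_smult th.N'.tensor_zero_right x one_N' e_closed)
  then have "th.ext (frag_of (Inl x, e)) \<in> th.N'.T"
    using x xe by (simp add: N'_def)
  moreover have "inj_on (tensor_map R N' M id) (carrier (tensor_product R N M))"
    using flat id N N' unfolding flat_module_def by auto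
  ultimately have T: "frag_of (Inl x, e) \<in> th.N.T"
    unfolding th.tensor_map_inj_iff using x_N e_closed by auto
  define K where "K = (\<lambda>j. Inl (j \<otimes> x) :: 'a + 'u) ` Ann"
  have "Inl x \<in> K"
  proof (rule tensor_generator_zero_imp[OF N _ _ x_N T])
    show "a \<odot>\<^bsub>N\<^esub> n \<in> K" if "a \<in> Ann" "n \<in> carrier N" for a n
      using that x
      by (auto simp: K_def N_def cgenideal_def R.m_assoc[symmetric] Ann.Icarr intro!: imageI Ann.I_r_closed)
    show "additive_subgroup K N"
    proof (rule additive_subgroupI, rule N.M.add.subgroupI)
      show "K \<subseteq> carrier N"
        using Ann.Icarr by (fastforce simp: K_def N_def cgenideal_def)
      show "K \<noteq> {}"
        using zero_in_Ann unfolding K_def by blast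
      fix y assume "y \<in> K"
      then obtain j where j: "j \<in> Ann" "y = Inl (j \<otimes> x)"
        by (auto simp: K_def)
      have "Inl ((\<ominus> j) \<otimes> x) \<oplus>\<^bsub>N\<^esub> y = \<zero>\<^bsub>N\<^esub>"
        using j x Ann.Icarr by (simp add: N_def R.l_minus R.l_neg)
      then have "\<ominus>\<^bsub>N\<^esub> y = Inl ((\<ominus> j) \<otimes> x)"
        using j x Ann.Icarr[OF j(1)]
        by (intro N.M.minus_equality) (auto simp: N_def cgenideal_def intro!: imageI)
      then show "\<ominus>\<^bsub>N\<^esub> y \<in> K"
        using j by (auto simp: K_def)
      fix z assume "z \<in> K"
      then obtain k where k: "k \<in> Ann" "z = Inl (k \<otimes> x)"
        by (auto simp: K_def)
      then have "y \<oplus>\<^bsub>N\<^esub> z = Inl ((j \<oplus> k) \<otimes> x)"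
        using j x Ann.Icarr by (simp add: N_def R.l_distr)
      then show "y \<oplus>\<^bsub>N\<^esub> z \<in> K"
        using j k by (auto simp: K_def)
    qed
  qed
  then obtain g where "g \<in> Ann" "x = g \<otimes> x"
    unfolding K_def by blast
  then show "\<exists>g\<in>Ann. g \<otimes> x = x"
    by (intro bexI[of _ g]) simp_all
qed

lemma flat_iff_has_local_units:
  "flat_module TYPE('a + 'u) R M \<longleftrightarrow> has_local_units R Ann"
  by (rule iffI[OF flat_imp_has_local_units has_local_units_imp_flat])

end

lemma (in cring) pure_ideal_iff_has_local_units:
  assumes "ideal I R"
  shows "pure_ideal TYPE('a + 'u) I R \<longleftrightarrow> has_local_units R I"
proof -
  interpret I: ideal I R by (rule assms)
  let ?Q = "restrict_scalars (R Quot I) (\<lambda>a. I +> a)"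
  have carr: "carrier ?Q = (\<lambda>a. I +> a) ` carrier R"
    by (auto simp: restrict_scalars_def FactRing_def A_RCOSETS_def')
  have smult: "a \<odot>\<^bsub>?Q\<^esub> (I +> b) = I +> (a \<otimes> b)" if "a \<in> carrier R" "b \<in> carrier R" for a b
    using that by (simp add: restrict_scalars_def FactRing_def I.rcoset_mult_add)
  have add: "(I +> a) \<oplus>\<^bsub>?Q\<^esub> (I +> b) = I +> (a \<oplus> b)" if "a \<in> carrier R" "b \<in> carrier R" for a b
    using that by (simp add: restrict_scalars_def FactRing_def I.a_rcos_sum)
  have zero: "\<zero>\<^bsub>?Q\<^esub> = I"
    by (simp add: restrict_scalars_def FactRing_def)
  interpret Q: ring "R Quot I"
    by (rule I.quotient_is_ring)
  have ab: "abelian_group ?Q"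
  proof (rule abelian_groupI)
    show "\<exists>y\<in>carrier ?Q. y \<oplus>\<^bsub>?Q\<^esub> x = \<zero>\<^bsub>?Q\<^esub>" if "x \<in> carrier ?Q" for x
      using that Q.l_neg[of x] Q.a_inv_closed[of x] by (auto simp: restrict_scalars_def)
  qed (simp_all add: restrict_scalars_def Q.a_ac)
  have mod: "module R ?Q"
    by (rule moduleI[OF is_cring ab])
      (auto simp: carr smult add l_distr r_distr m_assoc)
  interpret cyclic_module R ?Q "I +> \<one>"
  proof (intro cyclic_module.intro mod cyclic_module_axioms.intro)
    show "\<exists>a\<in>carrier R. y = a \<odot>\<^bsub>?Q\<^esub> (I +> \<one>)" if "y \<in> carrier ?Q" for y
      using that by (auto simp: carr smult)
  qed (simp add: carr)
  have "I +> a = I \<longleftrightarrow> a \<in> I" if "a \<in> carrier R" for a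
    using that I.rcos_const_imp_mem a_rcos_zero[OF assms] by blast
  then have "a \<in> Ann \<longleftrightarrow> a \<in> I" for a
    using I.Icarr[of a] by (cases "a \<in> carrier R") (simp_all add: Ann_def smult zero, blast)
  then have "Ann = I"
    by blast
  then have "flat_module TYPE('a + 'u) R ?Q \<longleftrightarrow> has_local_units R I"
    by (simp add: flat_iff_has_local_units)
  then show ?thesis
    by (simp add: pure_ideal_def flat_ring_hom_def assms I.rcos_ring_hom)
qed

lemma (in cring) flat_principal_ideal_iff:
  assumes f: "f \<in> carrier R"
  shows "flat_module TYPE('a + 'u) R (ideal_module R (PIdl f)) \<longleftrightarrow> has_local_units R (annihilator R f)"
proof -
  let ?M = "ideal_module R (PIdl f)"
  have mod: "module R ?M"
    by (intro module_ideal_module cgenideal_ideal f)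
  interpret cyclic_module R ?M f
  proof (intro cyclic_module.intro mod cyclic_module_axioms.intro)
    show "f \<in> carrier ?M"
      using cgenideal_self[OF f] by (simp add: ideal_module_def)
    show "\<exists>a\<in>carrier R. y = a \<odot>\<^bsub>?M\<^esub> f" if "y \<in> carrier ?M" for y
      using that by (auto simp: ideal_module_def cgenideal_def)
  qed
  have "Ann = annihilator R f"
    by (simp add: Ann_def annihilator_def)
  then show ?thesis
    by (simp add: flat_iff_has_local_units)
qed

section \<open>Kernels of localization maps\<close>

text \<open>The kernel of the canonical map from \<open>R\<close> to its localization at \<open>Q\<close>, described without fractions.\<close>

definition localization_kernel :: "('a, 'm) ring_scheme \<Rightarrow> 'a set \<Rightarrow> 'a set" where
  "localization_kernel R Q = {x \<in> carrier R. \<exists>s \<in> carrier R - Q. s \<otimes>\<^bsub>R\<^esub> x = \<zero>\<^bsub>R\<^esub>}"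

lemma (in primeideal) complement_mult_closed:
  "s \<in> carrier R - I \<Longrightarrow> t \<in> carrier R - I \<Longrightarrow> s \<otimes> t \<in> carrier R - I"
  using I_prime by auto

lemma (in primeideal) one_not_in: "\<one> \<notin> I"
  using one_imp_carrier I_notcarr by auto

lemma (in primeideal) localization_kernel_ideal: "ideal (localization_kernel R I) R"
proof (rule idealI[OF ring_axioms], rule add.subgroupI)
  show "localization_kernel R I \<noteq> {}"
    using one_not_in by (auto simp: localization_kernel_def intro!: exI[of _ \<zero>] bexI[of _ \<one>])
  fix a assume "a \<in> localization_kernel R I"
  then obtain s where a: "a \<in> carrier R" and s: "s \<in> carrier R - I" "s \<otimes> a = \<zero>"
    by (auto simp: localization_kernel_def)
  show "\<ominus> a \<in> localization_kernel R I"
    using a s by (auto simp: localization_kernel_def r_minus intro!: bexI[of _ s])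
  show "x \<otimes> a \<in> localization_kernel R I" if "x \<in> carrier R" for x
    using a s that by (auto simp: localization_kernel_def m_lcomm[of s x a] intro!: bexI[of _ s])
  then show "a \<otimes> x \<in> localization_kernel R I" if "x \<in> carrier R" for x
    using a that by (simp add: m_comm[of a x])
  fix b assume "b \<in> localization_kernel R I"
  then obtain t where b: "b \<in> carrier R" and t: "t \<in> carrier R - I" "t \<otimes> b = \<zero>"
    by (auto simp: localization_kernel_def)
  have "(s \<otimes> t) \<otimes> (a \<oplus> b) = t \<otimes> (s \<otimes> a) \<oplus> s \<otimes> (t \<otimes> b)"
    using a b s(1) t(1) by (simp add: r_distr m_ac)
  also have "\<dots> = \<zero>"
    using s t by simp
  finally show "a \<oplus> b \<in> localization_kernel R I"
    using a b complement_mult_closed[OF s(1) t(1)] unfolding localization_kernel_def by blast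
qed (auto simp: localization_kernel_def)

text \<open>If \<open>s x = 0 \<in> P\<close> with \<open>s\<close> outside the larger prime, then \<open>x \<in> P\<close>. Hence, as soon as the kernel
  is prime, it is the least prime ideal inside \<open>I\<close>; this is how unique minimal primes arise.\<close>

lemma (in primeideal) localization_kernel_subset:
  assumes P: "primeideal P R" and "P \<subseteq> I"
  shows "localization_kernel R I \<subseteq> P"
proof
  interpret P: primeideal P R by (rule P)
  fix x assume "x \<in> localization_kernel R I"
  then obtain s where "x \<in> carrier R" "s \<in> carrier R" "s \<notin> I" "s \<otimes> x = \<zero>"
    by (auto simp: localization_kernel_def)
  then show "x \<in> P"
    using P.I_prime[of s x] \<open>P \<subseteq> I\<close> by auto
qed

lemma (in primeideal) primeideal_localization_kernel_iff:
  "primeideal (localization_kernel R I) R \<longleftrightarrow>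
    (\<forall>a \<in> carrier R. \<forall>b \<in> carrier R. a \<otimes> b \<in> localization_kernel R I \<longrightarrow>
      a \<in> localization_kernel R I \<or> b \<in> localization_kernel R I)"
proof -
  have "localization_kernel R I \<subseteq> I"
    by (rule localization_kernel_subset[OF primeideal_axioms order_refl])
  then have "carrier R \<noteq> localization_kernel R I"
    using one_not_in by blast
  then show ?thesis
    using primeideal.I_prime primeidealI[OF localization_kernel_ideal is_cring] by meson
qed

section \<open>The ring of fractions\<close>

locale mult_submonoid = cring R for R (structure) +
  fixes S
  assumes S_subset: "S \<subseteq> carrier R"
    and one_in_S: "\<one> \<in> S"
    and mult_in_S: "\<And>s t. s \<in> S \<Longrightarrow> t \<in> S \<Longrightarrow> s \<otimes> t \<in> S"
begin

abbreviation "L \<equiv> localization R S"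

lemma S_carr [simp]: "s \<in> S \<Longrightarrow> s \<in> carrier R"
  using S_subset by blast

declare one_in_S [simp] mult_in_S [simp]

lemma fraction_rel_iff:
  "((a, s), (b, t)) \<in> fraction_rel R S \<longleftrightarrow>
    a \<in> carrier R \<and> s \<in> S \<and> b \<in> carrier R \<and> t \<in> S \<and> (\<exists>u\<in>S. u \<otimes> (a \<otimes> t) = u \<otimes> (b \<otimes> s))"
proof -
  have "u \<otimes> ((a \<otimes> t) \<ominus> (b \<otimes> s)) = \<zero> \<longleftrightarrow> u \<otimes> (a \<otimes> t) = u \<otimes> (b \<otimes> s)"
    if "a \<in> carrier R" "s \<in> S" "b \<in> carrier R" "t \<in> S" "u \<in> S" for u
    using that r_right_minus_eq[of "u \<otimes> (a \<otimes> t)" "u \<otimes> (b \<otimes> s)"]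
    by (simp add: a_minus_def r_distr r_minus)
  then show ?thesis
    unfolding fraction_rel_def by auto
qed

lemma equiv_fraction_rel: "equiv (carrier R \<times> S) (fraction_rel R S)"
proof (rule equivI)
  show "fraction_rel R S \<subseteq> (carrier R \<times> S) \<times> (carrier R \<times> S)"
    by (auto simp: fraction_rel_def)
  show "refl_on (carrier R \<times> S) (fraction_rel R S)"
    by (rule refl_onI) (auto simp: fraction_rel_iff intro: one_in_S)
  show "sym (fraction_rel R S)"
    by (rule symI) (auto simp: fraction_rel_iff, metis)
  show "trans (fraction_rel R S)"
  proof (rule transI, clarsimp simp: fraction_rel_iff)
    fix a s b t c r u v
    assume carr: "a \<in> carrier R" "s \<in> S" "b \<in> carrier R" "t \<in> S" "c \<in> carrier R" "r \<in> S" "u \<in> S" "v \<in> S"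
      and 1: "u \<otimes> (a \<otimes> t) = u \<otimes> (b \<otimes> s)" and 2: "v \<otimes> (b \<otimes> r) = v \<otimes> (c \<otimes> t)"
    have "(u \<otimes> v \<otimes> t) \<otimes> (a \<otimes> r) = (v \<otimes> r) \<otimes> (u \<otimes> (a \<otimes> t))"
      using carr by (simp add: m_ac)
    also have "\<dots> = (u \<otimes> s) \<otimes> (v \<otimes> (b \<otimes> r))"
      unfolding 1 using carr by (simp add: m_ac)
    also have "\<dots> = (u \<otimes> v \<otimes> t) \<otimes> (c \<otimes> s)"
      unfolding 2 using carr by (simp add: m_ac)
    finally show "\<exists>w\<in>S. w \<otimes> (a \<otimes> r) = w \<otimes> (c \<otimes> s)"
      using carr by (meson mult_in_S)
  qed
qed

lemma fraction_eq_iff: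
  assumes "a \<in> carrier R" "s \<in> S" "b \<in> carrier R" "t \<in> S"
  shows "fraction R S a s = fraction R S b t \<longleftrightarrow> (\<exists>u\<in>S. u \<otimes> (a \<otimes> t) = u \<otimes> (b \<otimes> s))"
proof -
  have "fraction R S a s = fraction R S b t \<longleftrightarrow> ((a, s), (b, t)) \<in> fraction_rel R S"
    unfolding fraction_def
    by (rule eq_equiv_class_iff[OF equiv_fraction_rel]) (use assms in simp_all)
  then show ?thesis
    by (simp add: fraction_rel_iff assms)
qed

lemma carrier_localization: "carrier L = {fraction R S a s | a s. a \<in> carrier R \<and> s \<in> S}"
  by (auto simp: localization_def quotient_def fraction_def)

lemma fraction_closed [simp]: "a \<in> carrier R \<Longrightarrow> s \<in> S \<Longrightarrow> fraction R S a s \<in> carrier L"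
  by (auto simp: carrier_localization)

lemma fraction_cases:
  assumes "x \<in> carrier L"
  obtains a s where "a \<in> carrier R" "s \<in> S" "x = fraction R S a s"
  using assms by (auto simp: carrier_localization)

text \<open>The operations of the localization are unions over all representatives; for an operation that respects
  equality of fractions, the union collapses to the value at any one pair of representatives.\<close>

lemma union_over_fractions:
  assumes F: "\<And>a s a' s' b t b' t'. ((a, s), (a', s')) \<in> fraction_rel R S \<Longrightarrow>
      ((b, t), (b', t')) \<in> fraction_rel R S \<Longrightarrow> F a s b t = F a' s' b' t'"
    and "a \<in> carrier R" "s \<in> S" "b \<in> carrier R" "t \<in> S"
  shows "(\<Union>(a, s) \<in> fraction R S a s. \<Union>(b, t) \<in> fraction R S b t. F a s b t) = F a s b t"
proof -
  have "(\<Union>p \<in> fraction_rel R S `` {(a, s)}. \<Union>q \<in> fraction_rel R S `` {(b, t)}.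
      F (fst p) (snd p) (fst q) (snd q)) = F (fst (a, s)) (snd (a, s)) (fst (b, t)) (snd (b, t))"
    using assms by (intro UN_equiv_class2[OF equiv_fraction_rel equiv_fraction_rel] congruent2I') auto
  then show ?thesis
    by (simp add: fraction_def split_beta)
qed

lemma mult_fraction:
  assumes "a \<in> carrier R" "s \<in> S" "b \<in> carrier R" "t \<in> S"
  shows "fraction R S a s \<otimes>\<^bsub>L\<^esub> fraction R S b t = fraction R S (a \<otimes> b) (s \<otimes> t)"
proof -
  have "fraction R S (a \<otimes> b) (s \<otimes> t) = fraction R S (a' \<otimes> b') (s' \<otimes> t')"
    if as: "((a, s), (a', s')) \<in> fraction_rel R S" and bt: "((b, t), (b', t')) \<in> fraction_rel R S"
    for a s a' s' b t b' t'
  proof -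
    obtain u v where u: "u \<in> S" "u \<otimes> (a \<otimes> s') = u \<otimes> (a' \<otimes> s)"
      and v: "v \<in> S" "v \<otimes> (b \<otimes> t') = v \<otimes> (b' \<otimes> t)"
      using as bt unfolding fraction_rel_iff by blast
    have carr: "a \<in> carrier R" "s \<in> S" "a' \<in> carrier R" "s' \<in> S"
      "b \<in> carrier R" "t \<in> S" "b' \<in> carrier R" "t' \<in> S"
      using as bt unfolding fraction_rel_iff by blast+
    have "(u \<otimes> v) \<otimes> ((a \<otimes> b) \<otimes> (s' \<otimes> t')) = (u \<otimes> (a \<otimes> s')) \<otimes> (v \<otimes> (b \<otimes> t'))"
      using carr u(1) v(1) by (simp add: m_ac)
    also have "\<dots> = (u \<otimes> v) \<otimes> ((a' \<otimes> b') \<otimes> (s \<otimes> t))"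
      unfolding u(2) v(2) using carr u(1) v(1) by (simp add: m_ac)
    finally show ?thesis
      using carr u(1) v(1) by (subst fraction_eq_iff) (auto intro: mult_in_S)
  qed
  then have "(\<Union>(a, s) \<in> fraction R S a s. \<Union>(b, t) \<in> fraction R S b t. fraction R S (a \<otimes> b) (s \<otimes> t))
      = fraction R S (a \<otimes> b) (s \<otimes> t)"
    by (rule union_over_fractions) (use assms in auto)
  then show ?thesis
    by (simp add: localization_def)
qed

lemma add_fraction:
  assumes "a \<in> carrier R" "s \<in> S" "b \<in> carrier R" "t \<in> S"
  shows "fraction R S a s \<oplus>\<^bsub>L\<^esub> fraction R S b t = fraction R S ((a \<otimes> t) \<oplus> (b \<otimes> s)) (s \<otimes> t)"
proof -
  have "fraction R S ((a \<otimes> t) \<oplus> (b \<otimes> s)) (s \<otimes> t) = fraction R S ((a' \<otimes> t') \<oplus> (b' \<otimes> s')) (s' \<otimes> t')"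
    if as: "((a, s), (a', s')) \<in> fraction_rel R S" and bt: "((b, t), (b', t')) \<in> fraction_rel R S"
    for a s a' s' b t b' t'
  proof -
    obtain u v where u: "u \<in> S" "u \<otimes> (a \<otimes> s') = u \<otimes> (a' \<otimes> s)"
      and v: "v \<in> S" "v \<otimes> (b \<otimes> t') = v \<otimes> (b' \<otimes> t)"
      using as bt unfolding fraction_rel_iff by blast
    have carr: "a \<in> carrier R" "s \<in> S" "a' \<in> carrier R" "s' \<in> S"
      "b \<in> carrier R" "t \<in> S" "b' \<in> carrier R" "t' \<in> S"
      using as bt unfolding fraction_rel_iff by blast+
    have "(u \<otimes> v) \<otimes> (((a \<otimes> t) \<oplus> (b \<otimes> s)) \<otimes> (s' \<otimes> t'))
        = (v \<otimes> (t \<otimes> t')) \<otimes> (u \<otimes> (a \<otimes> s')) \<oplus> (u \<otimes> (s \<otimes> s')) \<otimes> (v \<otimes> (b \<otimes> t'))"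
      using carr u(1) v(1) by (simp add: l_distr r_distr m_ac)
    also have "\<dots> = (u \<otimes> v) \<otimes> (((a' \<otimes> t') \<oplus> (b' \<otimes> s')) \<otimes> (s \<otimes> t))"
      unfolding u(2) v(2) using carr u(1) v(1) by (simp add: l_distr r_distr m_ac)
    finally show ?thesis
      using carr u(1) v(1) by (subst fraction_eq_iff) (auto intro: mult_in_S)
  qed
  then have "(\<Union>(a, s) \<in> fraction R S a s. \<Union>(b, t) \<in> fraction R S b t.
      fraction R S ((a \<otimes> t) \<oplus> (b \<otimes> s)) (s \<otimes> t)) = fraction R S ((a \<otimes> t) \<oplus> (b \<otimes> s)) (s \<otimes> t)"
    by (rule union_over_fractions) (use assms in auto)
  then show ?thesis
    by (simp add: localization_def)
qed

lemma zero_localization: "\<zero>\<^bsub>L\<^esub> = fraction R S \<zero> \<one>"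
  by (simp add: localization_def)

lemma one_localization: "\<one>\<^bsub>L\<^esub> = fraction R S \<one> \<one>"
  by (simp add: localization_def)

lemma fraction_eq_zero_iff:
  assumes "a \<in> carrier R" "s \<in> S"
  shows "fraction R S a s = \<zero>\<^bsub>L\<^esub> \<longleftrightarrow> (\<exists>u\<in>S. u \<otimes> a = \<zero>)"
proof -
  have "u \<otimes> (a \<otimes> \<one>) = u \<otimes> (\<zero> \<otimes> s) \<longleftrightarrow> u \<otimes> a = \<zero>" if "u \<in> S" for u
    using assms that by simp
  then show ?thesis
    unfolding zero_localization fraction_eq_iff[OF assms zero_closed one_in_S] by blast
qed

lemma cancel_fraction:
  assumes "a \<in> carrier R" "s \<in> S" "u \<in> S"
  shows "fraction R S (u \<otimes> a) (u \<otimes> s) = fraction R S a s"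
proof -
  have "\<one> \<otimes> ((u \<otimes> a) \<otimes> s) = \<one> \<otimes> (a \<otimes> (u \<otimes> s))"
    using assms by (simp add: m_ac)
  then show ?thesis
    using assms by (subst fraction_eq_iff) (auto intro: one_in_S)
qed

lemma cring_localization: "cring L"
proof (rule cringI)
  show "abelian_group L"
  proof (rule abelian_groupI)
    show "\<zero>\<^bsub>L\<^esub> \<in> carrier L"
      by (simp add: zero_localization)
    fix x assume "x \<in> carrier L"
    then obtain a s where x: "a \<in> carrier R" "s \<in> S" "x = fraction R S a s"
      by (rule fraction_cases)
    show "\<zero>\<^bsub>L\<^esub> \<oplus>\<^bsub>L\<^esub> x = x"
      using x by (simp add: zero_localization add_fraction)
    have "fraction R S (\<ominus> a) s \<oplus>\<^bsub>L\<^esub> x = \<zero>\<^bsub>L\<^esub>"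
      using x by (auto simp: add_fraction fraction_eq_zero_iff l_minus l_neg intro!: bexI[of _ \<one>])
    then show "\<exists>y\<in>carrier L. y \<oplus>\<^bsub>L\<^esub> x = \<zero>\<^bsub>L\<^esub>"
      using x by (intro bexI[of _ "fraction R S (\<ominus> a) s"]) simp_all
    fix y assume "y \<in> carrier L"
    then obtain b t where y: "b \<in> carrier R" "t \<in> S" "y = fraction R S b t"
      by (rule fraction_cases)
    show "x \<oplus>\<^bsub>L\<^esub> y \<in> carrier L"
      using x y by (simp add: add_fraction)
    show "x \<oplus>\<^bsub>L\<^esub> y = y \<oplus>\<^bsub>L\<^esub> x"
      using x y by (simp add: add_fraction m_comm a_comm)
    fix z assume "z \<in> carrier L"
    then obtain c r where z: "c \<in> carrier R" "r \<in> S" "z = fraction R S c r"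
      by (rule fraction_cases)
    show "x \<oplus>\<^bsub>L\<^esub> y \<oplus>\<^bsub>L\<^esub> z = x \<oplus>\<^bsub>L\<^esub> (y \<oplus>\<^bsub>L\<^esub> z)"
      using x y z by (simp add: add_fraction l_distr r_distr m_ac a_ac)
  qed
  show "Group.comm_monoid L"
  proof (rule comm_monoidI)
    show "\<one>\<^bsub>L\<^esub> \<in> carrier L"
      by (simp add: one_localization)
    fix x assume "x \<in> carrier L"
    then obtain a s where x: "a \<in> carrier R" "s \<in> S" "x = fraction R S a s"
      by (rule fraction_cases)
    show "\<one>\<^bsub>L\<^esub> \<otimes>\<^bsub>L\<^esub> x = x"
      using x by (simp add: one_localization mult_fraction)
    fix y assume "y \<in> carrier L"
    then obtain b t where y: "b \<in> carrier R" "t \<in> S" "y = fraction R S b t"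
      by (rule fraction_cases)
    show "x \<otimes>\<^bsub>L\<^esub> y \<in> carrier L" "x \<otimes>\<^bsub>L\<^esub> y = y \<otimes>\<^bsub>L\<^esub> x"
      using x y by (simp_all add: mult_fraction m_comm)
    fix z assume "z \<in> carrier L"
    then obtain c r where z: "c \<in> carrier R" "r \<in> S" "z = fraction R S c r"
      by (rule fraction_cases)
    show "x \<otimes>\<^bsub>L\<^esub> y \<otimes>\<^bsub>L\<^esub> z = x \<otimes>\<^bsub>L\<^esub> (y \<otimes>\<^bsub>L\<^esub> z)"
      using x y z by (simp add: mult_fraction m_assoc)
  qed
  fix x y z assume "x \<in> carrier L" "y \<in> carrier L" "z \<in> carrier L"
  then obtain a s b t c r where x: "a \<in> carrier R" "s \<in> S" "x = fraction R S a s"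
    and y: "b \<in> carrier R" "t \<in> S" "y = fraction R S b t"
    and z: "c \<in> carrier R" "r \<in> S" "z = fraction R S c r"
    by (meson fraction_cases)
  \<comment> \<open>The two sides of the distributive law differ by a factor \<open>r\<close> in numerator and denominator.\<close>
  have "x \<otimes>\<^bsub>L\<^esub> z \<oplus>\<^bsub>L\<^esub> y \<otimes>\<^bsub>L\<^esub> z
      = fraction R S (r \<otimes> (((a \<otimes> t) \<oplus> (b \<otimes> s)) \<otimes> c)) (r \<otimes> ((s \<otimes> t) \<otimes> r))"
    using x y z by (simp add: add_fraction mult_fraction l_distr r_distr m_ac)
  also have "\<dots> = (x \<oplus>\<^bsub>L\<^esub> y) \<otimes>\<^bsub>L\<^esub> z"
    using x y z by (subst cancel_fraction) (simp_all add: add_fraction mult_fraction)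
  finally show "(x \<oplus>\<^bsub>L\<^esub> y) \<otimes>\<^bsub>L\<^esub> z = x \<otimes>\<^bsub>L\<^esub> z \<oplus>\<^bsub>L\<^esub> y \<otimes>\<^bsub>L\<^esub> z"
    by simp
qed

lemma domain_localization_iff:
  "domain L \<longleftrightarrow> \<zero> \<notin> S \<and>
    (\<forall>a \<in> carrier R. \<forall>b \<in> carrier R. (\<exists>u\<in>S. u \<otimes> (a \<otimes> b) = \<zero>) \<longrightarrow>
      (\<exists>u\<in>S. u \<otimes> a = \<zero>) \<or> (\<exists>u\<in>S. u \<otimes> b = \<zero>))"
  (is "_ \<longleftrightarrow> _ \<and> ?zd")
proof -
  have one: "\<one>\<^bsub>L\<^esub> \<noteq> \<zero>\<^bsub>L\<^esub> \<longleftrightarrow> \<zero> \<notin> S"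
    using fraction_eq_zero_iff[of \<one> \<one>] by (auto simp: one_localization)
  have "(\<forall>x\<in>carrier L. \<forall>y\<in>carrier L. x \<otimes>\<^bsub>L\<^esub> y = \<zero>\<^bsub>L\<^esub> \<longrightarrow> x = \<zero>\<^bsub>L\<^esub> \<or> y = \<zero>\<^bsub>L\<^esub>) \<longleftrightarrow> ?zd"
    (is "?integral \<longleftrightarrow> _")
  proof
    show ?zd if ?integral
    proof (intro ballI impI)
      fix a b assume ab: "a \<in> carrier R" "b \<in> carrier R" "\<exists>u\<in>S. u \<otimes> (a \<otimes> b) = \<zero>"
      have "fraction R S a \<one> \<otimes>\<^bsub>L\<^esub> fraction R S b \<one> = \<zero>\<^bsub>L\<^esub>"
        using ab by (simp add: mult_fraction fraction_eq_zero_iff)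
      then have "fraction R S a \<one> = \<zero>\<^bsub>L\<^esub> \<or> fraction R S b \<one> = \<zero>\<^bsub>L\<^esub>"
        using that ab by simp
      then show "(\<exists>u\<in>S. u \<otimes> a = \<zero>) \<or> (\<exists>u\<in>S. u \<otimes> b = \<zero>)"
        using ab by (simp add: fraction_eq_zero_iff)
    qed
    show ?integral if ?zd
    proof (intro ballI impI)
      fix x y assume xy: "x \<in> carrier L" "y \<in> carrier L" "x \<otimes>\<^bsub>L\<^esub> y = \<zero>\<^bsub>L\<^esub>"
      then obtain a s b t where x: "a \<in> carrier R" "s \<in> S" "x = fraction R S a s"
        and y: "b \<in> carrier R" "t \<in> S" "y = fraction R S b t"
        by (meson fraction_cases)
      then have "\<exists>u\<in>S. u \<otimes> (a \<otimes> b) = \<zero>"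
        using xy(3) by (simp add: mult_fraction fraction_eq_zero_iff)
      then show "x = \<zero>\<^bsub>L\<^esub> \<or> y = \<zero>\<^bsub>L\<^esub>"
        using that x y by (simp add: fraction_eq_zero_iff)
    qed
  qed
  then show ?thesis
    using cring_localization one unfolding domain_def domain_axioms_def by blast
qed

end

lemma (in primeideal) complement_mult_submonoid: "mult_submonoid R (carrier R - I)"
  by unfold_locales (use one_not_in complement_mult_closed in auto)

text \<open>A fraction is zero exactly if its numerator lies in the kernel, so being a domain only concerns
  products of numerators.\<close>

lemma (in primeideal) domain_localization_at_iff:
  "domain (localization_at R I) \<longleftrightarrow> primeideal (localization_kernel R I) R"
proof -
  interpret S: mult_submonoid R "carrier R - I"
    by (rule complement_mult_submonoid)
  have zero: "\<zero> \<notin> carrier R - I"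
    by simp
  have kernel: "x \<in> localization_kernel R I \<longleftrightarrow> (\<exists>u \<in> carrier R - I. u \<otimes> x = \<zero>)"
    if "x \<in> carrier R" for x
    using that by (simp add: localization_kernel_def)
  have "domain (localization_at R I) \<longleftrightarrow>
      (\<forall>a \<in> carrier R. \<forall>b \<in> carrier R. a \<otimes> b \<in> localization_kernel R I \<longrightarrow>
        a \<in> localization_kernel R I \<or> b \<in> localization_kernel R I)"
    unfolding localization_at_def S.domain_localization_iff using zero by (simp add: kernel)
  then show ?thesis
    unfolding primeideal_localization_kernel_iff .
qed

section \<open>Domains as localizations, reduced mp-rings, and minimal primes\<close>

context cring
begin

text \<open>Suppose \<open>s a b = 0\<close> with \<open>s \<notin> Q\<close> and let \<open>u\<close> be a unit for \<open>b\<close> in \<open>Ann (s a)\<close>. One of \<open>u\<close> and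
  \<open>\<one> - u\<close> is outside \<open>Q\<close>: in the first case \<open>u s\<close> kills \<open>a\<close>, in the second \<open>\<one> - u\<close> kills \<open>b\<close>.\<close>

lemma local_units_imp_primeideal_localization_kernel:
  assumes units: "\<And>f. f \<in> carrier R \<Longrightarrow> has_local_units R (annihilator R f)" and Q: "primeideal Q R"
  shows "primeideal (localization_kernel R Q) R"
proof -
  interpret Q: primeideal Q R by (rule Q)
  show ?thesis
    unfolding Q.primeideal_localization_kernel_iff
  proof (intro ballI impI)
    fix a b assume a: "a \<in> carrier R" and b: "b \<in> carrier R" and "a \<otimes> b \<in> localization_kernel R Q"
    then obtain s where s: "s \<in> carrier R - Q" "s \<otimes> (a \<otimes> b) = \<zero>"
      by (auto simp: localization_kernel_def)
    then have "b \<in> annihilator R (s \<otimes> a)"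
      using a b by (simp add: annihilator_def m_ac)
    then obtain u where "u \<in> annihilator R (s \<otimes> a)" and ub: "u \<otimes> b = b"
      using units[of "s \<otimes> a"] a s unfolding has_local_units_def by auto
    then have u: "u \<in> carrier R" "(u \<otimes> s) \<otimes> a = \<zero>"
      using a s by (auto simp: annihilator_def m_assoc)
    show "a \<in> localization_kernel R Q \<or> b \<in> localization_kernel R Q"
    proof (cases "u \<in> Q")
      case False
      then have "u \<otimes> s \<in> carrier R - Q"
        using u s Q.complement_mult_closed by blast
      then show ?thesis
        using a u unfolding localization_kernel_def by blast
    next
      case True
      have "\<one> = (\<one> \<ominus> u) \<oplus> u"
        using u by (simp add: a_minus_def a_assoc l_neg)
      then have "\<one> \<ominus> u \<notin> Q"
        using Q.one_not_in Q.a_closed[OF _ True] by metis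
      moreover have "(\<one> \<ominus> u) \<otimes> b = \<zero>"
        using u b ub by (simp add: a_minus_def l_distr l_minus r_neg)
      ultimately have "b \<in> localization_kernel R Q"
        using b u(1) unfolding localization_kernel_def by blast
      then show ?thesis ..
    qed
  qed
qed

text \<open>If \<open>f g = 0\<close>, one of \<open>f\<close> and \<open>g\<close> vanishes in the localization at \<open>M\<close>, so its annihilator is not
  contained in \<open>M\<close>. Hence no maximal ideal contains both annihilators.\<close>

lemma primeideal_localization_kernel_imp_comaximal:
  assumes prime: "\<And>M. maximalideal M R \<Longrightarrow> primeideal (localization_kernel R M) R"
    and f: "f \<in> carrier R" and g: "g \<in> carrier R" and fg: "f \<otimes> g = \<zero>"
  shows "annihilator R f <+> annihilator R g = carrier R"
proof (rule comaximalI[OF annihilator_ideal[OF f] annihilator_ideal[OF g]])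
  fix M assume M: "maximalideal M R" "annihilator R f \<subseteq> M" "annihilator R g \<subseteq> M"
  have "\<zero> \<in> localization_kernel R M"
    using primeideal.axioms(1)[OF prime[OF M(1)]]
    by (intro additive_subgroup.zero_closed ideal.axioms(1))
  then have "f \<in> localization_kernel R M \<or> g \<in> localization_kernel R M"
    using primeideal.I_prime[OF prime[OF M(1)] f g] fg by simp
  then show False
    using M by (auto simp: localization_kernel_def annihilator_def)
qed

text \<open>If \<open>a^(m+2) = 0\<close>, a unit \<open>u\<close> for \<open>a\<close> in \<open>Ann (a^(m+1))\<close> gives \<open>a^(m+1) = u a^(m+1) = 0\<close>, so the
  exponent goes down to one.\<close>

lemma local_units_imp_reduced:
  assumes units: "\<And>f. f \<in> carrier R \<Longrightarrow> has_local_units R (annihilator R f)"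
  shows "reduced_ring R"
  unfolding reduced_ring_def
proof (intro ballI allI impI)
  fix a and n :: nat assume a: "a \<in> carrier R" and "a [^] n = \<zero>"
  then show "a = \<zero>"
  proof (induction n)
    case 0
    then have "\<one> = \<zero>"
      by simp
    then show ?case
      using l_one[OF a] l_null[OF a] by metis
  next
    case (Suc n)
    show ?case
    proof (cases n)
      case 0
      then show ?thesis
        using Suc by simp
    next
      case (Suc m)
      have "a \<in> annihilator R (a [^] n)"
        using a Suc.prems by (simp add: annihilator_def m_comm)
      then obtain u where "u \<in> annihilator R (a [^] n)" and ua: "u \<otimes> a = a"
        using units[of "a [^] n"] a unfolding has_local_units_def by auto
      then have u: "u \<in> carrier R" "u \<otimes> a [^] n = \<zero>"
        by (auto simp: annihilator_def)
      have "a [^] n = a [^] m \<otimes> (u \<otimes> a)"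
        by (simp add: Suc ua)
      also have "\<dots> = u \<otimes> a [^] n"
        using a u(1) by (simp add: Suc m_ac)
      finally show ?thesis
        using Suc.IH a u(2) by simp
    qed
  qed
qed

lemma local_units_imp_mp_ring:
  assumes units: "\<And>f. f \<in> carrier R \<Longrightarrow> has_local_units R (annihilator R f)"
  shows "mp_ring R"
  unfolding mp_ring_def
proof (intro conjI is_cring allI impI)
  fix Q assume Q: "primeideal Q R"
  let ?K = "localization_kernel R Q"
  have K: "primeideal ?K R"
    by (rule local_units_imp_primeideal_localization_kernel[OF units Q])
  have least: "?K \<subseteq> P" if "primeideal P R" "P \<subseteq> Q" for P
    using primeideal.localization_kernel_subset[OF Q] that .
  have KQ: "?K \<subseteq> Q"
    by (rule least[OF Q order_refl])
  show "\<exists>!P. minimal_primeideal P R \<and> P \<subseteq> Q"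
  proof (rule ex1I[of _ ?K])
    have "P = ?K" if "primeideal P R" "P \<subseteq> ?K" for P
      using least[of P] that KQ by blast
    then show "minimal_primeideal ?K R \<and> ?K \<subseteq> Q"
      using K KQ by (auto simp: minimal_primeideal_def)
    show "P = ?K" if "minimal_primeideal P R \<and> P \<subseteq> Q" for P
      using that K least[of P] unfolding minimal_primeideal_def by auto
  qed
qed

text \<open>Let \<open>x \<in> P\<close> and suppose that a maximal ideal \<open>M\<close> contains \<open>P\<close> and \<open>Ann x\<close>. Then \<open>s x \<noteq> 0\<close> for all
  \<open>s \<notin> M\<close>, and since the ring is reduced also \<open>s x^n \<noteq> 0\<close>. A prime avoiding all these products lies
  in \<open>M\<close> and omits \<open>x\<close>; the minimal prime below it must be \<open>P\<close> by uniqueness in \<open>M\<close>, which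
  contradicts \<open>x \<in> P\<close>.\<close>

lemma minimal_primeideal_has_local_units:
  assumes reduced: "reduced_ring R" and mp: "mp_ring R" and P: "minimal_primeideal P R"
  shows "has_local_units R P"
proof -
  have P_prime: "primeideal P R"
    using P by (simp add: minimal_primeideal_def)
  interpret P: primeideal P R by (rule P_prime)
  have "annihilator R x <+> P = carrier R" if "x \<in> P" for x
  proof (rule comaximalI[OF annihilator_ideal[OF P.Icarr[OF that]] P.is_ideal])
    fix M assume M: "maximalideal M R" and xM: "annihilator R x \<subseteq> M" and PM: "P \<subseteq> M"
    have x: "x \<in> carrier R"
      by (rule P.Icarr[OF that])
    have M_prime: "primeideal M R"
      by (rule maximalideal_prime[OF M])
    interpret M: primeideal M R by (rule M_prime)
    define S where "S = {s \<otimes> x [^] n | s (n :: nat). s \<in> carrier R - M}"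
    have S: "s \<in> S" if "t \<in> carrier R - M" "s = t \<otimes> x [^] n" for s t and n :: nat
      using that unfolding S_def by blast
    obtain P' where P': "primeideal P' R" "P' \<inter> S = {}"
    proof (rule exists_primeideal_avoiding)
      show "\<one> \<in> S"
        using M.one_not_in x by (intro S[of \<one> _ 0]) auto
      show "y \<otimes> z \<in> S" if yz: "y \<in> S" "z \<in> S" for y z
      proof -
        obtain s t and n k :: nat where y: "y = s \<otimes> x [^] n" "s \<in> carrier R - M"
          and z: "z = t \<otimes> x [^] k" "t \<in> carrier R - M"
          using yz unfolding S_def by blast
        then have "y \<otimes> z = (s \<otimes> t) \<otimes> x [^] (n + k)"
          using x by (simp add: m_ac flip: nat_pow_mult)
        then show ?thesis
          using S M.complement_mult_closed y z by blast
      qed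
      show "\<zero> \<notin> S"
      proof
        assume "\<zero> \<in> S"
        then obtain s and n :: nat where s: "s \<in> carrier R - M" "\<zero> = s \<otimes> x [^] n"
          unfolding S_def by blast
        \<comment> \<open>With exponent \<open>Suc n\<close> rather than \<open>n\<close> the cofactor is \<open>s^n x\<close> also for \<open>n = 0\<close>.\<close>
        have "(s \<otimes> x) [^] Suc n = (s [^] n \<otimes> x) \<otimes> (s \<otimes> x [^] n)"
          using s(1) x by (simp add: nat_pow_distrib m_ac)
        also have "\<dots> = \<zero>"
          using s x by (simp flip: s(2))
        finally have "s \<otimes> x = \<zero>"
          using reduced s(1) x unfolding reduced_ring_def by (metis DiffD1 m_closed)
        then show False
          using s(1) xM by (auto simp: annihilator_def)
      qed
    qed
    interpret P': primeideal P' R by (rule P'(1))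
    have "P' \<subseteq> M"
    proof
      fix y assume y: "y \<in> P'"
      then have "y \<notin> S"
        using P'(2) by blast
      then show "y \<in> M"
        using S[of y y 0] P'.Icarr[OF y] by auto
    qed
    obtain P'' where P'': "minimal_primeideal P'' R" "P'' \<subseteq> P'"
      using mp P'(1) unfolding mp_ring_def by blast
    then have "P'' = P"
      using mp M_prime P PM \<open>P' \<subseteq> M\<close> unfolding mp_ring_def by blast
    then have "x \<in> P'"
      using P'' \<open>x \<in> P\<close> by blast
    moreover have "x \<in> S"
      using M.one_not_in x by (intro S[of \<one> _ 1]) auto
    ultimately show False
      using P'(2) by blast
  qed
  then show ?thesis
    using has_local_units_iff_comaximal[OF P.is_ideal] by blast
qed

text \<open>A maximal ideal \<open>M\<close> containing both annihilators contains a minimal prime \<open>P\<close>. If \<open>h \<in> P\<close>, then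
  \<open>Ann h + P\<close> is the whole ring, so \<open>Ann h\<close> is not inside \<open>M\<close>; thus \<open>f\<close> and \<open>g\<close> are both outside
  \<open>P\<close>, although \<open>f g = 0 \<in> P\<close>.\<close>

lemma minimal_primeideals_local_units_imp_comaximal:
  assumes units: "\<And>P. minimal_primeideal P R \<Longrightarrow> has_local_units R P"
    and f: "f \<in> carrier R" and g: "g \<in> carrier R" and fg: "f \<otimes> g = \<zero>"
  shows "annihilator R f <+> annihilator R g = carrier R"
proof (rule comaximalI[OF annihilator_ideal[OF f] annihilator_ideal[OF g]])
  fix M assume M: "maximalideal M R" "annihilator R f \<subseteq> M" "annihilator R g \<subseteq> M"
  interpret M: primeideal M R by (rule maximalideal_prime[OF M(1)])
  obtain P where P: "minimal_primeideal P R" "P \<subseteq> M"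
    using exists_minimal_primeideal[OF M.primeideal_axioms] by blast
  then interpret P: primeideal P R
    by (simp add: minimal_primeideal_def)
  have not_in: "h \<notin> P" if h: "annihilator R h \<subseteq> M" for h
  proof
    assume "h \<in> P"
    then have "annihilator R h <+> P = carrier R"
      using units[OF P(1)] has_local_units_iff_comaximal[OF P.is_ideal] by blast
    then have "\<one> \<in> annihilator R h <+> P"
      by simp
    then obtain u p where "u \<in> M" "p \<in> M" "\<one> = u \<oplus> p"
      using h P(2) by (auto simp: set_add_def')
    then show False
      using M.one_not_in M.a_closed by metis
  qed
  show False
    using P.I_prime[OF f g] fg not_in f g M by simp
qed

end

section \<open>The characterization of reduced mp-rings\<close>

lemma all_equivalent_single: "all_equivalent [P]"
  by (simp add: all_equivalent_def)

lemma all_equivalent_Cons: "all_equivalent (P # Q # Ps) \<longleftrightarrow> (P \<longleftrightarrow> Q) \<and> all_equivalent (Q # Ps)"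
  unfolding all_equivalent_def by auto

lemma (in cring) all_principalideals_iff:
  "(\<forall>I. principalideal I R \<longrightarrow> \<Phi> I) \<longleftrightarrow> (\<forall>f \<in> carrier R. \<Phi> (PIdl f))"
  using cgenideal_is_principalideal principalideal.generate cgenideal_eq_genideal by metis

theorem theorem6p4:
  fixes A :: "('a, 'm) ring_scheme" (structure)
  assumes "cring A"
  shows "all_equivalent
    [reduced_ring A \<and> mp_ring A,
     \<forall>f \<in> carrier A. \<forall>g \<in> carrier A. f \<otimes> g = \<zero> \<longrightarrow>
       annihilator A f <+> annihilator A g = carrier A,
     \<forall>f \<in> carrier A. \<forall>g \<in> carrier A.
       annihilator A f <+> annihilator A g = annihilator A (f \<otimes> g),
     \<forall>f \<in> carrier A. pure_ideal TYPE('a + 'u) (annihilator A f) A,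
     \<forall>I. principalideal I A \<longrightarrow> flat_module TYPE('a + 'u) A (ideal_module A I),
     \<forall>P. primeideal P A \<longrightarrow> domain (localization_at A P),
     \<forall>M. maximalideal M A \<longrightarrow> domain (localization_at A M),
     \<forall>P. minimal_primeideal P A \<longrightarrow> pure_ideal TYPE('a + 'u) P A]"
proof -
  interpret cring A by (rule assms)
  let ?comaximal = "\<forall>f \<in> carrier A. \<forall>g \<in> carrier A. f \<otimes> g = \<zero> \<longrightarrow>
      annihilator A f <+>\<^bsub>A\<^esub> annihilator A g = carrier A"
  have prime_kernel: "primeideal (localization_kernel A Q) A" if ?comaximal "primeideal Q A" for Q
    using local_units_imp_primeideal_localization_kernel that annihilators_have_local_units_iff by blast
  have minimal: "pure_ideal TYPE('a + 'u) P A \<longleftrightarrow> has_local_units A P" if "minimal_primeideal P A" for P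
    using that by (intro pure_ideal_iff_has_local_units) (simp add: minimal_primeideal_def primeideal.axioms(1))
  have comaximal_imp_i: "reduced_ring A \<and> mp_ring A" if ?comaximal
    using local_units_imp_reduced local_units_imp_mp_ring that annihilators_have_local_units_iff by blast
  have i_imp_viii: "\<forall>P. minimal_primeideal P A \<longrightarrow> pure_ideal TYPE('a + 'u) P A"
    if "reduced_ring A \<and> mp_ring A"
    using that minimal minimal_primeideal_has_local_units by blast
  have viii_imp_comaximal: ?comaximal
    if "\<forall>P. minimal_primeideal P A \<longrightarrow> pure_ideal TYPE('a + 'u) P A"
    using that minimal minimal_primeideals_local_units_imp_comaximal by blast
  have i: "reduced_ring A \<and> mp_ring A \<longleftrightarrow> ?comaximal"
    using comaximal_imp_i i_imp_viii viii_imp_comaximal by blast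
  have viii: "(\<forall>P. minimal_primeideal P A \<longrightarrow> pure_ideal TYPE('a + 'u) P A) \<longleftrightarrow> ?comaximal"
    using comaximal_imp_i i_imp_viii viii_imp_comaximal by blast
  have iv: "(\<forall>f \<in> carrier A. pure_ideal TYPE('a + 'u) (annihilator A f) A) \<longleftrightarrow> ?comaximal"
    unfolding annihilators_have_local_units_iff[symmetric]
    by (simp add: pure_ideal_iff_has_local_units annihilator_ideal)
  have v: "(\<forall>I. principalideal I A \<longrightarrow> flat_module TYPE('a + 'u) A (ideal_module A I)) \<longleftrightarrow> ?comaximal"
    unfolding annihilators_have_local_units_iff[symmetric] all_principalideals_iff
    by (simp add: flat_principal_ideal_iff)
  have vii_imp_comaximal: ?comaximal
    if "\<forall>M. maximalideal M A \<longrightarrow> domain (localization_at A M)"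
  proof (intro ballI impI)
    have "primeideal (localization_kernel A M) A" if "maximalideal M A" for M
      using \<open>\<forall>M. maximalideal M A \<longrightarrow> domain (localization_at A M)\<close> that
        primeideal.domain_localization_at_iff[OF maximalideal_prime[OF that]] by blast
    then show "annihilator A f <+>\<^bsub>A\<^esub> annihilator A g = carrier A"
      if "f \<in> carrier A" "g \<in> carrier A" "f \<otimes> g = \<zero>" for f g
      using primeideal_localization_kernel_imp_comaximal that by blast
  qed
  have comaximal_imp_vi: "\<forall>P. primeideal P A \<longrightarrow> domain (localization_at A P)" if ?comaximal
    using primeideal.domain_localization_at_iff prime_kernel[OF that] by blast
  have vi_imp_vii: "\<forall>M. maximalideal M A \<longrightarrow> domain (localization_at A M)"
    if "\<forall>P. primeideal P A \<longrightarrow> domain (localization_at A P)"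
    using that maximalideal_prime by blast
  have vi: "(\<forall>P. primeideal P A \<longrightarrow> domain (localization_at A P)) \<longleftrightarrow> ?comaximal"
    using comaximal_imp_vi vi_imp_vii vii_imp_comaximal by blast
  have vii: "(\<forall>M. maximalideal M A \<longrightarrow> domain (localization_at A M)) \<longleftrightarrow> ?comaximal"
    using comaximal_imp_vi vi_imp_vii vii_imp_comaximal by blast
  show ?thesis
    unfolding all_equivalent_Cons i iv v vi vii viii
    using comaximal_annihilators_iff_sum_formula all_equivalent_single by blast
qed

end
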